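(* Let $H_1,H_2$ be Hilbert spaces, $A_j\in\mathcal{B}(H_j)$ positive for $j=1,2$, and $X\in\mathcal{B}(H_2,H_1)$, and suppose $T=\begin{bmatrix}A_1 & X\\ X^* & A_2\end{bmatrix}$ is a positive operator on $H_1\oplus H_2$. If $T\in\mathcal{AM}(H_1\oplus H_2)$, then $A_j\in\mathcal{AM}(H_j)$ for $j=1,2$, $\sigma_{ess}(A_1)=\sigma_{ess}(A_2)$, and $X$ is compact.
   Context: Throughout, Hilbert spaces are complex, separable and infinite dimensional; $\mathcal{B}(H_1,H_2)$ denotes bounded linear operators. For $S\in\mathcal{B}(H_1,H_2)$ the minimum modulus is $m(S)=\inf\{\|Sx\|:\|x\|=1\}$; $S$ is minimum attaining if $\|Sx\|=m(S)$ for some unit vector $x$. $S$ is absolutely minimum attaining, written $S\in\mathcal{AM}(H_1,H_2)$ (and $\mathcal{AM}(H)=\mathcal{AM}(H,H)$), if for every nonzero closed subspace $M\subseteq H_1$ the restriction $S|_M$ is minimum attaining. $\sigma_{ess}(R)$ for $R\in\mathcal{B}(H)$ is the set of $\lambda\in\mathbb{C}$ with $R-\lambda I$ not Fredholm. *)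

theory Defs
  imports "HOL-Analysis.Analysis"
begin

class complex_vector = real_vector +
  fixes scaleC :: "complex \<Rightarrow> 'a \<Rightarrow> 'a"
  assumes scaleC_add_right: "scaleC a (x + y) = scaleC a x + scaleC a y"
    and scaleC_add_left: "scaleC (a + b) x = scaleC a x + scaleC b x"
    and scaleC_scaleC: "scaleC a (scaleC b x) = scaleC (a * b) x"
    and scaleC_one: "scaleC 1 x = x"
    and scaleR_scaleC: "scaleR r x = scaleC (complex_of_real r) x"

class complex_inner = complex_vector + real_normed_vector +
  fixes cinner :: "'a \<Rightarrow> 'a \<Rightarrow> complex"
  assumes cinner_commute: "cinner x y = cnj (cinner y x)"
    and cinner_add_left: "cinner (x + y) z = cinner x z + cinner y z"
    and cinner_scaleC_left: "cinner (scaleC c x) y = cnj c * cinner x y"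
    and cinner_ge_zero: "0 \<le> Re (cinner x x)"
    and cinner_eq_zero_iff: "cinner x x = 0 \<longleftrightarrow> x = 0"
    and norm_eq_sqrt_cinner: "norm x = sqrt (Re (cinner x x))"
begin

lemma cinner_self_Im: "Im (cinner x x) = 0"
  proof -
  have "Im (cinner x x) = Im (cnj (cinner x x))" using cinner_commute[of x x] by simp
  then show ?thesis by simp
qed

lemma norm_sq_cinner: "(norm x)^2 = Re (cinner x x)"
  using norm_eq_sqrt_cinner cinner_ge_zero by simp

end

instantiation prod :: (complex_vector, complex_vector) complex_vector
begin
definition scaleC_prod_def: "scaleC c x = (scaleC c (fst x), scaleC c (snd x))"
instance
  by standard (simp_all add: scaleC_prod_def scaleC_add_right scaleC_add_left
      scaleC_scaleC scaleC_one scaleR_prod_def scaleR_scaleC prod_eq_iff)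
end

instantiation prod :: (complex_inner, complex_inner) complex_inner
begin
definition cinner_prod_def:
  "cinner x y = cinner (fst x) (fst y) + cinner (snd x) (snd y)"
instance
proof
  fix x y z :: "'a \<times> 'b" and c :: complex
  show "cinner x y = cnj (cinner y x)"
    by (simp add: cinner_prod_def cinner_commute[of "fst x"] cinner_commute[of "snd x"])
  show "cinner (x + y) z = cinner x z + cinner y z"
    by (simp add: cinner_prod_def cinner_add_left)
  show "cinner (scaleC c x) y = cnj c * cinner x y"
    by (simp add: cinner_prod_def scaleC_prod_def cinner_scaleC_left distrib_left)
  show "0 \<le> Re (cinner x x)"
    by (simp add: cinner_prod_def cinner_ge_zero add_nonneg_nonneg)
  show "cinner x x = 0 \<longleftrightarrow> x = 0"
  proof
    assume h: "cinner x x = 0"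
    then have "Re (cinner (fst x) (fst x)) + Re (cinner (snd x) (snd x)) = 0"
      by (simp add: cinner_prod_def flip: plus_complex.sel)
    then have "Re (cinner (fst x) (fst x)) = 0" "Re (cinner (snd x) (snd x)) = 0"
      using cinner_ge_zero[of "fst x"] cinner_ge_zero[of "snd x"] by linarith+
    then have "cinner (fst x) (fst x) = 0" "cinner (snd x) (snd x) = 0"
      using cinner_self_Im[of "fst x"] cinner_self_Im[of "snd x"] by (simp_all add: complex_eq_iff)
    then show "x = 0" by (simp add: cinner_eq_zero_iff prod_eq_iff)
  qed (simp add: cinner_prod_def cinner_eq_zero_iff[THEN iffD2])
  show "norm x = sqrt (Re (cinner x x))"
    by (simp add: norm_prod_def cinner_prod_def norm_sq_cinner)
qed
end

definition cspan :: "'a::complex_vector set \<Rightarrow> 'a set" where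
  "cspan S = {x. \<exists>F c. finite F \<and> F \<subseteq> S \<and> x = (\<Sum>s\<in>F. scaleC (c s) s)}"

definition csubspace :: "'a::complex_vector set \<Rightarrow> bool" where
  "csubspace M \<longleftrightarrow> 0 \<in> M \<and> (\<forall>x\<in>M. \<forall>y\<in>M. x + y \<in> M) \<and> (\<forall>c. \<forall>x\<in>M. scaleC c x \<in> M)"

definition closed_csubspace :: "'a::complex_inner set \<Rightarrow> bool" where
  "closed_csubspace M \<longleftrightarrow> csubspace M \<and> closed M"

text \<open>Standing assumptions on the Hilbert spaces: separable and infinite dimensional.\<close>
definition separable_inf_dim :: "'a::complex_inner itself \<Rightarrow> bool" where
  "separable_inf_dim _ \<longleftrightarrow>
     (\<exists>D::'a set. countable D \<and> closure D = UNIV) \<and>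
     (\<forall>F::'a set. finite F \<longrightarrow> cspan F \<noteq> UNIV)"

definition bounded_clinear :: "('a::complex_inner \<Rightarrow> 'b::complex_inner) \<Rightarrow> bool" where
  "bounded_clinear f \<longleftrightarrow> (\<forall>x y. f (x + y) = f x + f y) \<and>
     (\<forall>c x. f (scaleC c x) = scaleC c (f x)) \<and> (\<exists>K. \<forall>x. norm (f x) \<le> norm x * K)"

definition cadjoint :: "('a::complex_inner \<Rightarrow> 'b::complex_inner) \<Rightarrow> 'b \<Rightarrow> 'a" where
  "cadjoint X = (SOME Y. \<forall>x y. cinner (X x) y = cinner x (Y y))"

definition positive_op :: "('a::complex_inner \<Rightarrow> 'a) \<Rightarrow> bool" where
  "positive_op A \<longleftrightarrow> bounded_clinear A \<and> (\<forall>x. cinner x (A x) \<in> \<real> \<and> 0 \<le> Re (cinner x (A x)))"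

definition min_modulus_on :: "('a::complex_inner \<Rightarrow> 'b::complex_inner) \<Rightarrow> 'a set \<Rightarrow> real" where
  "min_modulus_on S M = Inf {norm (S x) | x. x \<in> M \<and> norm x = 1}"

definition min_attaining_on :: "('a::complex_inner \<Rightarrow> 'b::complex_inner) \<Rightarrow> 'a set \<Rightarrow> bool" where
  "min_attaining_on S M \<longleftrightarrow> (\<exists>x\<in>M. norm x = 1 \<and> norm (S x) = min_modulus_on S M)"

definition abs_min_attaining :: "('a::complex_inner \<Rightarrow> 'b::complex_inner) \<Rightarrow> bool" where
  "abs_min_attaining S \<longleftrightarrow>
     (\<forall>M. closed_csubspace M \<and> M \<noteq> {0} \<longrightarrow> min_attaining_on S M)"

definition fredholm :: "('a::complex_inner \<Rightarrow> 'b::complex_inner) \<Rightarrow> bool" where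
  "fredholm R \<longleftrightarrow> closed (range R) \<and>
     (\<exists>F. finite F \<and> cspan F = {x. R x = 0}) \<and>
     (\<exists>F. finite F \<and> cspan (range R \<union> F) = UNIV)"

definition ess_spectrum :: "('a::complex_inner \<Rightarrow> 'a) \<Rightarrow> complex set" where
  "ess_spectrum R = {l. \<not> fredholm (\<lambda>x. R x - scaleC l x)}"

definition compact_op :: "('a::complex_inner \<Rightarrow> 'b::complex_inner) \<Rightarrow> bool" where
  "compact_op X \<longleftrightarrow> compact (closure (X ` cball 0 1))"

end

theory Submission
  imports Defs "HOL-Complex_Analysis.Great_Picard"
begin

text \<open>
  Let \<open>\<beta>\<close> be the supremum of the minimum moduli of \<open>T\<close> on subspaces of finite codimension.
  If no subspace of finite codimension satisfied \<open>\<parallel>T y\<parallel> \<le> \<beta> \<parallel>y\<parallel>\<close>, one could pick an orthonormal sequence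
  with orthogonal images whose norms decrease to \<open>\<beta>\<close> without reaching it, and \<open>T\<close> would
  not attain its minimum on the closed span. Hence the quadratic form of \<open>T\<^sup>2 - \<beta>\<^sup>2\<close> is arbitrarily
  small on suitable subspaces of finite codimension, so \<open>T\<^sup>2 - \<beta>\<^sup>2 = (T + \<beta>) (T - \<beta>)\<close> and then
  \<open>T - \<beta>\<close> are compact. Both the compactness of \<open>T - \<beta>\<close> and the bound
  \<open>\<parallel>T y\<parallel> \<le> \<beta> \<parallel>y\<parallel>\<close> pass to the corners \<open>A1\<close>, \<open>A2\<close>, whose essential spectrum is therefore \<open>{\<beta>}\<close>;
  and conversely these two properties make an operator absolutely minimum attaining.
\<close>

subsection \<open>Complex inner product spaces\<close>

lemma cinner_add_right: "cinner x (y + z) = cinner x y + cinner x z"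
  by (metis cinner_commute cinner_add_left complex_cnj_add)

lemma cinner_scaleC_right: "cinner x (scaleC c y) = c * cinner x y"
  by (metis cinner_commute cinner_scaleC_left complex_cnj_cnj complex_cnj_mult)

lemma cinner_scaleR_left: "cinner (scaleR r x) y = complex_of_real r * cinner x y"
  by (simp add: scaleR_scaleC cinner_scaleC_left)

lemma cinner_scaleR_right: "cinner x (scaleR r y) = complex_of_real r * cinner x y"
  by (simp add: scaleR_scaleC cinner_scaleC_right)

lemma cinner_self: "cinner x x = complex_of_real ((norm x)\<^sup>2)"
  by (simp add: complex_eq_iff norm_sq_cinner cinner_self_Im)

lemma Re_cinner_commute: "Re (cinner x y) = Re (cinner y x)"
  by (subst cinner_commute) simp

lemma norm_add_sq: "(norm (x + y))\<^sup>2 = (norm x)\<^sup>2 + 2 * Re (cinner x y) + (norm y)\<^sup>2"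
  for x y :: "'a::complex_inner"
  using Re_cinner_commute[of x y]
  by (simp add: norm_sq_cinner cinner_add_left cinner_add_right)

lemma cnj_mult_self: "cnj z * z = complex_of_real ((cmod z)\<^sup>2)"
  by (metis complex_norm_square mult.commute)

lemma norm_scaleC: "norm (scaleC c x) = cmod c * norm x" for x :: "'a::complex_inner"
proof -
  have "(norm (scaleC c x))\<^sup>2 = Re ((cnj c * c) * cinner x x)"
    by (simp add: norm_sq_cinner cinner_scaleC_left cinner_scaleC_right cinner_self_Im algebra_simps)
  also have "\<dots> = (cmod c * norm x)\<^sup>2"
    unfolding cnj_mult_self cinner_self by (simp add: power_mult_distrib del: of_real_power flip: of_real_mult)
  finally show ?thesis
    by (simp add: power2_eq_iff_nonneg)
qed

lemma Cauchy_Schwarz: "cmod (cinner x y) \<le> norm x * norm y"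
proof (cases "y = 0")
  case True
  then show ?thesis
    using cinner_scaleR_right[of x 0 0] by simp
next
  case False
  define t where "t = cinner x y"
  \<comment> \<open>\<open>w\<close> is minus the orthogonal projection of \<open>x\<close> onto the
    line of \<open>y\<close>; the inequality is nonnegativity of the squared norm of
    \<open>x + w\<close>.\<close>
  define w where "w = scaleC (- (cnj t / complex_of_real ((norm y)\<^sup>2))) y"
  have "cinner x w = - (cnj t * t / complex_of_real ((norm y)\<^sup>2))"
    by (simp add: w_def cinner_scaleC_right t_def)
  also have "\<dots> = complex_of_real (- ((cmod t)\<^sup>2 / (norm y)\<^sup>2))"
    unfolding cnj_mult_self by simp
  finally have 1: "Re (cinner x w) = - ((cmod t)\<^sup>2 / (norm y)\<^sup>2)"
    by (simp del: of_real_minus of_real_divide of_real_power)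
  have 2: "(norm w)\<^sup>2 = (cmod t)\<^sup>2 / (norm y)\<^sup>2"
    using False by (simp add: w_def norm_scaleC norm_divide norm_power power_mult_distrib power_divide)
      (simp add: power2_eq_square power4_eq_xxxx)
  have "0 \<le> (norm (x + w))\<^sup>2" by simp
  also have "\<dots> = (norm x)\<^sup>2 - (cmod t)\<^sup>2 / (norm y)\<^sup>2"
    by (simp add: norm_add_sq 1 2)
  finally have "(cmod t)\<^sup>2 \<le> (norm x * norm y)\<^sup>2"
    using False by (simp add: field_simps)
  then show ?thesis
    unfolding t_def by (rule power2_le_imp_le) simp
qed

text \<open>Real bilinearity with a bound gives access to the library rules for limits, continuity,
  differences and sums of inner products.\<close>

lemma bounded_bilinear_cinner: "bounded_bilinear (cinner :: 'a::complex_inner \<Rightarrow> 'a \<Rightarrow> complex)"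
proof
  show "\<exists>K. \<forall>a b::'a. cmod (cinner a b) \<le> norm a * norm b * K"
    by (intro exI[of _ 1]) (simp add: Cauchy_Schwarz)
qed (simp_all add: cinner_add_left cinner_add_right cinner_scaleR_left cinner_scaleR_right scaleR_conv_of_real)

interpretation cinner: bounded_bilinear "cinner :: 'a::complex_inner \<Rightarrow> 'a \<Rightarrow> complex"
  by (rule bounded_bilinear_cinner)

lemma scaleC_linear: "Real_Vector_Spaces.bounded_linear (scaleC c :: 'a::complex_inner \<Rightarrow> 'a)"
proof
  show "\<exists>K. \<forall>x::'a. norm (scaleC c x) \<le> norm x * K"
    by (intro exI[of _ "cmod c"]) (simp add: norm_scaleC mult.commute)
qed (simp_all add: scaleC_add_right scaleR_scaleC scaleC_scaleC mult.commute)

lemma scaleC_left_linear: "Real_Vector_Spaces.bounded_linear (\<lambda>c. scaleC c (x::'a::complex_inner))"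
proof
  show "\<exists>K. \<forall>c. norm (scaleC c x) \<le> norm c * K"
    by (intro exI[of _ "norm x"]) (simp add: norm_scaleC)
qed (simp_all add: scaleC_add_left scaleR_scaleC scaleC_scaleC scaleR_conv_of_real)

lemmas scaleC_right_zero = linear_0[OF bounded_linear.linear[OF scaleC_linear]]
  and scaleC_right_diff = linear_diff[OF bounded_linear.linear[OF scaleC_linear]]
  and scaleC_right_sum = linear_sum[OF bounded_linear.linear[OF scaleC_linear]]
  and scaleC_right_tendsto = bounded_linear.tendsto[OF scaleC_linear]
  and scaleC_left_zero = linear_0[OF bounded_linear.linear[OF scaleC_left_linear]]
  and scaleC_left_diff = linear_diff[OF bounded_linear.linear[OF scaleC_left_linear]]
  and scaleC_left_sum = linear_sum[OF bounded_linear.linear[OF scaleC_left_linear]]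

lemma norm_diff_sq: "(norm (x - y))\<^sup>2 = (norm x)\<^sup>2 - 2 * Re (cinner x y) + (norm y)\<^sup>2"
  for x y :: "'a::complex_inner"
  using norm_add_sq[of x "- y"] by (simp add: cinner.minus_right)

lemma parallelogram: "(norm (x - y))\<^sup>2 + (norm (x + y))\<^sup>2 = 2 * (norm x)\<^sup>2 + 2 * (norm y)\<^sup>2"
  for x y :: "'a::complex_inner"
  by (simp add: norm_add_sq norm_diff_sq)

subsection \<open>Subspaces and orthogonality\<close>

lemma csubspace_scaleR: "csubspace M \<Longrightarrow> x \<in> M \<Longrightarrow> scaleR r x \<in> M"
  by (simp add: csubspace_def scaleR_scaleC)

lemma csubspace_diff: "csubspace M \<Longrightarrow> x \<in> M \<Longrightarrow> y \<in> M \<Longrightarrow> x - y \<in> M"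
  for M :: "'a::complex_inner set"
  using csubspace_scaleR[of M y "-1"] by (force simp: csubspace_def)

lemma csubspace_sum: "csubspace M \<Longrightarrow> (\<And>i. i \<in> I \<Longrightarrow> f i \<in> M) \<Longrightarrow> (\<Sum>i\<in>I. f i) \<in> M"
  by (induction I rule: infinite_finite_induct) (auto simp: csubspace_def)

lemma csubspace_imp_subspace: "csubspace M \<Longrightarrow> subspace M"
  by (simp add: subspace_def csubspace_scaleR) (simp add: csubspace_def)

lemma csubspace_Int: "csubspace M \<Longrightarrow> csubspace N \<Longrightarrow> csubspace (M \<inter> N)"
  by (simp add: csubspace_def)

lemma csubspace_UNIV: "csubspace UNIV"
  by (simp add: csubspace_def)

lemma csubspace_cspan: "csubspace (cspan S)" for S :: "'a::complex_inner set"
  unfolding csubspace_def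
proof (intro conjI ballI allI)
  show "0 \<in> cspan S"
    by (auto simp: cspan_def intro!: exI[of _ "{}"])
next
  fix x y assume "x \<in> cspan S" "y \<in> cspan S"
  then obtain F c G d where F: "finite F" "F \<subseteq> S" "x = (\<Sum>s\<in>F. scaleC (c s) s)"
    and G: "finite G" "G \<subseteq> S" "y = (\<Sum>s\<in>G. scaleC (d s) s)"
    by (auto simp: cspan_def)
  \<comment> \<open>Extending both coefficient functions by zero lets the two sums run over the
    common index set \<open>F \<union> G\<close>.\<close>
  define c' d' where "c' s = (if s \<in> F then c s else 0)" and "d' s = (if s \<in> G then d s else 0)" for s
  have "x = (\<Sum>s\<in>F \<union> G. scaleC (c' s) s)"
    unfolding F c'_def using F G by (intro sum.mono_neutral_cong_left) (auto simp: scaleC_left_zero)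
  moreover have "y = (\<Sum>s\<in>F \<union> G. scaleC (d' s) s)"
    unfolding G d'_def using F G by (intro sum.mono_neutral_cong_left) (auto simp: scaleC_left_zero)
  ultimately have "x + y = (\<Sum>s\<in>F \<union> G. scaleC (c' s + d' s) s)"
    by (simp add: scaleC_add_left sum.distrib)
  then show "x + y \<in> cspan S"
    unfolding cspan_def using F G by (intro CollectI exI[of _ "F \<union> G"]) auto
next
  fix a x assume "x \<in> cspan S"
  then obtain F c where F: "finite F" "F \<subseteq> S" "x = (\<Sum>s\<in>F. scaleC (c s) s)"
    by (auto simp: cspan_def)
  then have "scaleC a x = (\<Sum>s\<in>F. scaleC (a * c s) s)"
    by (simp add: scaleC_right_sum scaleC_scaleC)
  then show "scaleC a x \<in> cspan S"
    unfolding cspan_def using F by (intro CollectI exI[of _ F] exI[of _ "\<lambda>s. a * c s"]) simp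
qed

lemma cspan_superset: "S \<subseteq> cspan S"
proof
  fix x assume "x \<in> S"
  then show "x \<in> cspan S"
    unfolding cspan_def by (intro CollectI exI[of _ "{x}"] exI[of _ "\<lambda>_. 1"]) (simp add: scaleC_one)
qed

lemma cspan_minimal: "csubspace M \<Longrightarrow> S \<subseteq> M \<Longrightarrow> cspan S \<subseteq> M"
  unfolding cspan_def by (auto intro!: csubspace_sum) (auto simp: csubspace_def)

lemma csubspace_closure: "csubspace M \<Longrightarrow> csubspace (closure M)" for M :: "'a::complex_inner set"
  unfolding csubspace_def
proof (intro conjI ballI allI; elim conjE)
  assume "0 \<in> M" then show "0 \<in> closure M" using closure_subset by blast
next
  fix x y assume M: "\<forall>x\<in>M. \<forall>y\<in>M. x + y \<in> M" and "x \<in> closure M" "y \<in> closure M"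
  then obtain f g where "\<And>n. f n \<in> M" "f \<longlonglongrightarrow> x" "\<And>n. g n \<in> M" "g \<longlonglongrightarrow> y"
    unfolding closure_sequential by blast
  then show "x + y \<in> closure M"
    unfolding closure_sequential using M by (intro exI[of _ "\<lambda>n. f n + g n"]) (auto intro: tendsto_intros)
next
  fix x c assume M: "\<forall>c. \<forall>x\<in>M. scaleC c x \<in> M" and "x \<in> closure M"
  then obtain f where "\<And>n. f n \<in> M" "f \<longlonglongrightarrow> x"
    unfolding closure_sequential by blast
  then show "scaleC c x \<in> closure M"
    unfolding closure_sequential using M by (intro exI[of _ "\<lambda>n. scaleC c (f n)"]) (auto intro: scaleC_right_tendsto)
qed

text \<open>For finite \<open>G\<close> these sets serve as the closed subspaces of finite
  codimension. The variable sits in the linear slot of \<open>cinner\<close>.\<close>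

definition orth :: "'a::complex_inner set \<Rightarrow> 'a set" where
  "orth G = {x. \<forall>g\<in>G. cinner g x = 0}"

lemma orth_Un: "orth (G \<union> H) = orth G \<inter> orth H"
  by (auto simp: orth_def)

lemma orth_antimono: "G \<subseteq> H \<Longrightarrow> orth H \<subseteq> orth G"
  by (auto simp: orth_def)

lemma cinner_eq_0_commute: "cinner x y = 0 \<longleftrightarrow> cinner y x = 0"
  by (metis cinner_commute complex_cnj_zero)

lemma csubspace_orth: "csubspace (orth G)"
  by (simp add: csubspace_def orth_def cinner.zero_right cinner_add_right cinner_scaleC_right)

lemma closed_orth: "closed (orth G)"
proof -
  have "orth G = (\<Inter>g\<in>G. {x. cinner g x = 0})"
    by (auto simp: orth_def)
  moreover have "closed {x. cinner g x = 0}" for g :: 'a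
    by (intro closed_Collect_eq continuous_intros cinner.continuous_on)
  ultimately show ?thesis
    by (simp add: closed_INT)
qed

lemma orth_cspan: "orth (cspan G) = orth G"
proof
  show "orth (cspan G) \<subseteq> orth G"
    by (rule orth_antimono[OF cspan_superset])
  have "cspan G \<subseteq> orth (orth G)"
    by (rule cspan_minimal[OF csubspace_orth]) (auto simp: orth_def cinner_eq_0_commute)
  then show "orth G \<subseteq> orth (cspan G)"
    unfolding orth_def by (blast dest: cinner_eq_0_commute[THEN iffD1])
qed

text \<open>\<open>M \<inter> orth G\<close> has finite codimension in \<open>M\<close>: subtracting
  a combination of finitely many vectors of \<open>M\<close>, with coefficients
  \<open>cinner g x\<close>, moves any \<open>x\<close> in \<open>M\<close> into
  \<open>orth G\<close>. The vectors are built by elimination, one constraint at a time.\<close>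

lemma biorthogonal_system:
  assumes "finite G" "csubspace M"
  shows "\<exists>u. (\<forall>g\<in>G. u g \<in> M) \<and> (\<forall>x\<in>M. x - (\<Sum>g\<in>G. scaleC (cinner g x) (u g)) \<in> orth G)"
  using assms(1)
proof (induction G)
  case empty
  then show ?case by (simp add: orth_def)
next
  case (insert g G)
  from insert.IH obtain u where u: "\<And>h. h \<in> G \<Longrightarrow> u h \<in> M"
    and uo: "\<And>x. x \<in> M \<Longrightarrow> x - (\<Sum>h\<in>G. scaleC (cinner h x) (u h)) \<in> orth G" by blast
  define p where "p x = (\<Sum>h\<in>G. scaleC (cinner h x) (u h))" for x
  have pM: "p x \<in> M" for x
    unfolding p_def using u assms(2) by (intro csubspace_sum) (auto simp: csubspace_def)
  \<comment> \<open>\<open>v\<close> corrects the new constraint \<open>g\<close> without disturbing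
    the old ones: a vector of \<open>M \<inter> orth G\<close> with \<open>cinner g v = 1\<close>,
    or 0 when \<open>g\<close> already vanishes on that subspace.\<close>
  obtain v where v: "v \<in> M" "v \<in> orth G"
    and vg: "\<And>x. x \<in> M \<Longrightarrow> x \<in> orth G \<Longrightarrow> cinner g (x - scaleC (cinner g x) v) = 0"
  proof (cases "\<exists>y. y \<in> M \<and> y \<in> orth G \<and> cinner g y \<noteq> 0")
    case True
    then obtain y where y: "y \<in> M" "y \<in> orth G" "cinner g y \<noteq> 0" by blast
    show thesis
    proof (rule that[of "scaleC (1 / cinner g y) y"])
      show "scaleC (1 / cinner g y) y \<in> M" using y assms(2) by (simp add: csubspace_def)
      show "scaleC (1 / cinner g y) y \<in> orth G" using y csubspace_orth by (force simp add: csubspace_def)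
    qed (simp add: cinner.diff_right cinner_scaleC_right y)
  next
    case False
    then show thesis
      using that[of 0] assms(2) csubspace_orth[of G] by (auto simp: csubspace_def scaleC_right_zero cinner.diff_right cinner.zero_right)
  qed
  \<comment> \<open>The old vectors lose their \<open>g\<close> component along \<open>v\<close>, so
    the new remainder is the old remainder \<open>x - p x\<close> corrected once along
    \<open>v\<close>.\<close>
  define u' where "u' h = (if h = g then v else u h - scaleC (cinner g (u h)) v)" for h
  have "x - (\<Sum>h\<in>insert g G. scaleC (cinner h x) (u' h)) \<in> orth (insert g G)" if x: "x \<in> M" for x
  proof -
    have "(\<Sum>h\<in>G. scaleC (cinner h x) (u' h)) = (\<Sum>h\<in>G. scaleC (cinner h x) (u h) - scaleC (cinner h x * cinner g (u h)) v)"
      using insert.hyps by (intro sum.cong) (auto simp: u'_def scaleC_right_diff scaleC_scaleC)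
    also have "\<dots> = p x - scaleC (\<Sum>h\<in>G. cinner h x * cinner g (u h)) v"
      by (simp add: p_def sum_subtractf scaleC_left_sum)
    also have "(\<Sum>h\<in>G. cinner h x * cinner g (u h)) = cinner g (p x)"
      by (simp add: p_def cinner.sum_right cinner_scaleC_right)
    finally have eq: "x - (\<Sum>h\<in>insert g G. scaleC (cinner h x) (u' h))
        = (x - p x) - scaleC (cinner g (x - p x)) v" (is "?l = ?r")
      using insert.hyps by (simp add: u'_def cinner.diff_right scaleC_left_diff)
    moreover have xp: "x - p x \<in> M" "x - p x \<in> orth G"
      using x pM assms(2) uo by (auto simp: csubspace_diff p_def)
    moreover have "?r \<in> orth G"
      using xp v csubspace_orth[of G] by (intro csubspace_diff[of _ "x - p x"]) (auto simp: csubspace_def)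
    ultimately show ?thesis unfolding eq using vg[OF xp] by (simp add: orth_def)
  qed
  moreover have "\<forall>h\<in>insert g G. u' h \<in> M"
    using u v assms(2) by (auto simp: u'_def intro!: csubspace_diff) (auto simp: csubspace_def)
  ultimately show ?case by blast
qed

text \<open>A sequence minimising the distance to \<open>W\<close> is Cauchy by the parallelogram
  law. Its limit \<open>p\<close> is a closest point, and a residual not orthogonal to
  \<open>W\<close> could be shortened further.\<close>

lemma projection_exists:
  fixes W :: "'a::{complex_inner,complete_space} set"
  assumes W: "csubspace W" "closed W"
  obtains p where "p \<in> W" "x - p \<in> orth W"
proof -
  define d where "d = infdist x W"
  have W0: "W \<noteq> {}" using W by (auto simp: csubspace_def)
  have dle: "d \<le> norm (x - w)" if "w \<in> W" for w
    using infdist_le[OF that, of x] by (simp add: d_def dist_norm)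
  have d0: "0 \<le> d" by (simp add: d_def infdist_nonneg)
  have "\<exists>w\<in>W. norm (x - w) < d + 1 / Suc n" for n
  proof -
    have "infdist x W < d + 1 / Suc n" by (simp add: d_def)
    then show ?thesis
      using W0 cInf_lessD[of "dist x ` W"] by (auto simp: infdist_notempty dist_norm)
  qed
  then obtain w where w: "\<And>n. w n \<in> W" "\<And>n. norm (x - w n) < d + 1 / Suc n" by metis
  have lim: "(\<lambda>n. norm (x - w n)) \<longlonglongrightarrow> d"
  proof (rule tendsto_sandwich[OF _ _ tendsto_const])
    show "(\<lambda>n. d + 1 / Suc n) \<longlonglongrightarrow> d"
      using LIMSEQ_inverse_real_of_nat_add[of d] by (simp add: inverse_eq_divide)
  qed (use w dle in \<open>auto intro!: always_eventually less_imp_le\<close>)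
  \<comment> \<open>The midpoint of \<open>w m\<close> and \<open>w n\<close> lies in
    \<open>W\<close>, hence at distance at least \<open>d\<close> from \<open>x\<close>; the
    parallelogram law turns this into a bound on their difference.\<close>
  have est: "(norm (w m - w n))\<^sup>2 \<le> 2 * (norm (x - w m))\<^sup>2 + 2 * (norm (x - w n))\<^sup>2 - 4 * d\<^sup>2" for m n
  proof -
    have "scaleR (1/2) (w m + w n) \<in> W"
      using W w by (intro csubspace_scaleR) (auto simp: csubspace_def)
    from dle[OF this] have "2 * d \<le> norm (scaleR 2 (x - scaleR (1/2) (w m + w n)))" by simp
    also have "scaleR 2 (x - scaleR (1/2) (w m + w n)) = (x - w m) + (x - w n)"
      by (simp add: algebra_simps scaleR_2)
    finally have "(2 * d)\<^sup>2 \<le> (norm ((x - w m) + (x - w n)))\<^sup>2"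
      using d0 by (intro power_mono) auto
    moreover have "norm ((x - w m) - (x - w n)) = norm (w m - w n)"
      by (simp add: norm_minus_commute)
    ultimately show ?thesis
      using parallelogram[of "x - w m" "x - w n"] by (simp add: power_mult_distrib)
  qed
  have "Cauchy w"
  proof (rule metric_CauchyI)
    fix e :: real assume e: "0 < e"
    have "(\<lambda>n. 4 * (norm (x - w n))\<^sup>2 - 4 * d\<^sup>2) \<longlonglongrightarrow> 4 * d\<^sup>2 - 4 * d\<^sup>2"
      by (intro tendsto_intros lim)
    then have "\<forall>\<^sub>F n in sequentially. 4 * (norm (x - w n))\<^sup>2 - 4 * d\<^sup>2 < e\<^sup>2"
      using e by (intro order_tendstoD(2)) auto
    then obtain N where N: "\<And>n. n \<ge> N \<Longrightarrow> 4 * (norm (x - w n))\<^sup>2 - 4 * d\<^sup>2 < e\<^sup>2"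
      by (auto simp: eventually_sequentially)
    have "dist (w m) (w n) < e" if "m \<ge> N" "n \<ge> N" for m n
    proof -
      have "(norm (w m - w n))\<^sup>2 < e\<^sup>2" using est[of m n] N[OF that(1)] N[OF that(2)] by linarith
      then show ?thesis using e by (simp add: dist_norm power2_less_imp_less)
    qed
    then show "\<exists>M. \<forall>m\<ge>M. \<forall>n\<ge>M. dist (w m) (w n) < e" by blast
  qed
  then obtain p where p: "w \<longlonglongrightarrow> p" using Cauchy_convergent convergent_def by blast
  have pW: "p \<in> W" using closed_sequentially[OF W(2) _ p] w by blast
  have "norm (x - p) = d"
    using LIMSEQ_unique[OF tendsto_norm[OF tendsto_diff[OF tendsto_const p]] lim] .
  have "cinner v (x - p) = 0" if v: "v \<in> W" for v
  proof (rule ccontr)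
    assume nz: "cinner v (x - p) \<noteq> 0"
    define t where "t = cinner v (x - p)"
    have v0: "v \<noteq> 0" using nz by (auto simp: cinner.zero_left)
    \<comment> \<open>The coefficient of the best approximation of \<open>x - p\<close> along
      \<open>v\<close>; moving by it lowers the squared distance by
      \<open>(cmod t)\<^sup>2 / (norm v)\<^sup>2\<close>.\<close>
    define c where "c = t / complex_of_real ((norm v)\<^sup>2)"
    have "p + scaleC c v \<in> W" using pW v W by (simp add: csubspace_def)
    then have "d \<le> norm ((x - p) - scaleC c v)" using dle by (simp add: diff_diff_add)
    then have "d\<^sup>2 \<le> (norm ((x - p) - scaleC c v))\<^sup>2" using d0 by (simp add: power_mono)
    also have "\<dots> = d\<^sup>2 - 2 * Re (c * cnj t) + (norm (scaleC c v))\<^sup>2"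
      using \<open>norm (x - p) = d\<close> cinner_commute[of "x - p" v]
      by (simp add: norm_diff_sq cinner_scaleC_right t_def)
    also have "c * cnj t = complex_of_real ((cmod t)\<^sup>2 / (norm v)\<^sup>2)"
      using cnj_mult_self[of t] by (simp add: c_def mult.commute)
    also have "(norm (scaleC c v))\<^sup>2 = (cmod t)\<^sup>2 / (norm v)\<^sup>2"
      using v0 by (simp add: c_def norm_scaleC norm_divide norm_power power_mult_distrib power_divide)
        (simp add: power2_eq_square power4_eq_xxxx)
    finally have "(cmod t)\<^sup>2 / (norm v)\<^sup>2 \<le> 0" by simp
    then show False using nz v0 by (simp add: t_def divide_le_0_iff)
  qed
  then show thesis using that[OF pW] by (simp add: orth_def)
qed

subsection \<open>Operators that are small on subspaces of finite codimension\<close>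

lemma bounded_clinear_imp_bounded_linear: "bounded_clinear f \<Longrightarrow> bounded_linear f"
  by (auto simp: bounded_clinear_def scaleR_scaleC bounded_linear_def bounded_linear_axioms_def
      intro!: linearI)

lemma bounded_clinear_scaleC: "bounded_clinear f \<Longrightarrow> f (scaleC c x) = scaleC c (f x)"
  by (simp add: bounded_clinear_def)

lemma bounded_clinear_add_scaleC:
  assumes "bounded_clinear f"
  shows "bounded_clinear (\<lambda>x. f x + scaleC c x)"
proof -
  interpret bounded_linear "\<lambda>x. f x + scaleC c x"
    by (intro bounded_linear_add scaleC_linear bounded_clinear_imp_bounded_linear assms)
  show ?thesis
    using assms bounded by (auto simp: bounded_clinear_def scaleC_add_right scaleC_scaleC mult.commute)
qed

lemma bounded_clinear_compose:
  assumes "bounded_clinear f" "bounded_clinear g"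
  shows "bounded_clinear (\<lambda>x. f (g x))"
proof -
  interpret bounded_linear "\<lambda>x. f (g x)"
    by (intro bounded_linear_compose[of f g] bounded_clinear_imp_bounded_linear assms)
  show ?thesis
    using assms bounded by (simp add: bounded_clinear_def)
qed

text \<open>For bounded operators on Hilbert spaces this is compactness, phrased as arbitrary
  smallness on subspaces of finite codimension. In this form it restricts directly to the summands
  of a product.\<close>

definition ess_null :: "('a::complex_inner \<Rightarrow> 'b::complex_inner) \<Rightarrow> bool" where
  "ess_null C \<longleftrightarrow> (\<forall>e>0. \<exists>G. finite G \<and> (\<forall>x\<in>orth G. norm (C x) \<le> e * norm x))"

section \<open>Compactness of essentially null operators\<close>

lemma weak_convergent_subseq:
  fixes x :: "nat \<Rightarrow> 'a::complex_inner"
  assumes "countable D" "\<And>n. norm (x n) \<le> K"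
  obtains r where "strict_mono r" "\<And>g. g \<in> D \<Longrightarrow> convergent (\<lambda>n. cinner g (x (r n)))"
proof -
  \<comment> \<open>The diagonal argument from the library needs one bound for all \<open>g\<close>;
    dividing by \<open>norm g + 1\<close> gives the bound \<open>K\<close>, and the summand 1 covers
    \<open>g = 0\<close>.\<close>
  define f where "f n g = cinner g (x n) / complex_of_real (norm g + 1)" for n g
  have K: "0 \<le> K" using assms(2) norm_ge_zero order_trans by blast
  have "cmod (f n g) \<le> K" for n g
  proof -
    have n: "norm (norm g + 1) = norm g + 1" by simp
    have "cmod (cinner g (x n)) \<le> norm g * norm (x n)" by (rule Cauchy_Schwarz)
    also have "\<dots> \<le> (norm g + 1) * K" using assms(2) K by (intro mult_mono) auto
    finally have "cmod (cinner g (x n)) \<le> K * (norm g + 1)" by (simp add: mult.commute)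
    moreover have "cmod (f n g) = cmod (cinner g (x n)) / (norm g + 1)"
      by (simp only: f_def norm_divide norm_of_real) simp
    ultimately show ?thesis by (simp add: divide_le_eq add_nonneg_pos)
  qed
  then obtain r where r: "strict_mono r" "\<And>g. g \<in> D \<Longrightarrow> \<exists>l. (\<lambda>n. f (r n) g) \<longlonglongrightarrow> l"
    using function_convergent_subsequence[OF assms(1), of f K] by blast
  have "convergent (\<lambda>n. cinner g (x (r n)))" if gD: "g \<in> D" for g
  proof -
    obtain l where "(\<lambda>n. f (r n) g) \<longlonglongrightarrow> l" using r(2)[OF gD] by blast
    then have "(\<lambda>n. complex_of_real (norm g + 1) * f (r n) g) \<longlonglongrightarrow> complex_of_real (norm g + 1) * l"
      by (intro tendsto_intros)
    moreover have "complex_of_real (norm g + 1) \<noteq> 0"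
      unfolding of_real_eq_0_iff using norm_ge_zero[of g] by linarith
    ultimately show ?thesis
      unfolding convergent_def f_def by auto
  qed
  then show thesis using that r(1) by blast
qed

text \<open>Along a subsequence all inner products with the countably many constraint vectors
  converge. For each \<open>k\<close> the finite dimensional part of \<open>x (r n)\<close> then
  converges, and on the remainder in \<open>orth (G k)\<close> the operator contributes at most a
  factor \<open>1 / Suc k\<close>.\<close>

lemma ess_null_convergent_subseq:
  fixes C :: "'a::complex_inner \<Rightarrow> 'b::{complex_inner,complete_space}" and x :: "nat \<Rightarrow> 'a"
  assumes bc: "bounded_clinear C" and null: "ess_null C" and K: "\<And>n. norm (x n) \<le> K"
  obtains r where "strict_mono r" "convergent (\<lambda>n. C (x (r n)))"
proof -
  interpret C: bounded_linear C by (rule bounded_clinear_imp_bounded_linear[OF bc])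
  have K0: "0 \<le> K" using K norm_ge_zero order_trans by blast
  have "\<forall>k. \<exists>G. finite G \<and> (\<forall>x\<in>orth G. norm (C x) \<le> 1 / Suc k * norm x)"
    using null unfolding ess_null_def by (metis of_nat_0_less_iff zero_less_Suc zero_less_divide_1_iff)
  then obtain G where G: "\<And>k. finite (G k)"
    and GC: "\<And>k x. x \<in> orth (G k) \<Longrightarrow> norm (C x) \<le> 1 / Suc k * norm x" by metis
  have cnt: "countable (\<Union>k. G k)" using G by (simp add: uncountable_infinite countable_finite)
  obtain r where r: "strict_mono r"
    and "\<And>g. g \<in> (\<Union>k. G k) \<Longrightarrow> convergent (\<lambda>n. cinner g (x (r n)))"
    using weak_convergent_subseq[where x = x, OF cnt K] by blast
  then have conv: "convergent (\<lambda>n. cinner g (x (r n)))" if "g \<in> G k" for k g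
    using that by blast
  have "Cauchy (\<lambda>n. C (x (r n)))"
  proof (rule metric_CauchyI)
    fix e :: real assume e: "0 < e"
    \<comment> \<open>\<open>2 * K + 1\<close> will bound the difference \<open>d\<close> of two
      remainders, so this \<open>k\<close> makes \<open>norm (C d)\<close> less than
      \<open>e / 2\<close>.\<close>
    obtain k :: nat where "2 * ((2 * K + 1) / e) < real k"
      using reals_Archimedean2 by blast
    then have k: "(2 * K + 1) / e < real (Suc k) / 2" by simp
    obtain u where u: "\<And>x. x - (\<Sum>g\<in>G k. scaleC (cinner g x) (u g)) \<in> orth (G k)"
      using biorthogonal_system[OF G csubspace_UNIV] by auto
    define y where "y n = (\<Sum>g\<in>G k. scaleC (cinner g (x (r n))) (u g))" for n
    have "\<forall>g\<in>G k. \<exists>l. (\<lambda>n. cinner g (x (r n))) \<longlonglongrightarrow> l"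
      using conv by (auto simp: convergent_def)
    then obtain l where l: "\<And>g. g \<in> G k \<Longrightarrow> (\<lambda>n. cinner g (x (r n))) \<longlonglongrightarrow> l g" by metis
    have y: "y \<longlonglongrightarrow> (\<Sum>g\<in>G k. scaleC (l g) (u g))"
      unfolding y_def by (intro tendsto_sum bounded_linear.tendsto[OF scaleC_left_linear] l)
    then have "Cauchy y" "Cauchy (\<lambda>n. C (y n))"
      using LIMSEQ_imp_Cauchy C.tendsto by blast+
    then obtain N1 N2 where N1: "\<And>m n. m \<ge> N1 \<Longrightarrow> n \<ge> N1 \<Longrightarrow> norm (y m - y n) < 1"
      and N2: "\<And>m n. m \<ge> N2 \<Longrightarrow> n \<ge> N2 \<Longrightarrow> norm (C (y m) - C (y n)) < e / 2"
      using e by (metis CauchyD half_gt_zero zero_less_one)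
    have "dist (C (x (r m))) (C (x (r n))) < e" if "m \<ge> max N1 N2" "n \<ge> max N1 N2" for m n
    proof -
      define d where "d = (x (r m) - y m) - (x (r n) - y n)"
      have "d \<in> orth (G k)"
        unfolding d_def y_def by (intro csubspace_diff csubspace_orth u)
      then have "norm (C d) \<le> 1 / Suc k * norm d" by (rule GC)
      also have "norm d \<le> 2 * K + 1"
      proof -
        have "norm d = norm ((x (r m) - x (r n)) - (y m - y n))" by (simp add: d_def algebra_simps)
        also have "\<dots> \<le> norm (x (r m)) + norm (x (r n)) + norm (y m - y n)"
          by (meson norm_triangle_ineq4 order_trans add_right_mono)
        finally show ?thesis using K[of "r m"] K[of "r n"] N1[of m n] that by simp
      qed
      finally have "norm (C d) \<le> 1 / Suc k * (2 * K + 1)" by (simp add: divide_right_mono)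
      also have "\<dots> < e / 2" using k e by (simp add: field_simps)
      finally have "norm (C d) < e / 2" .
      moreover have "C (x (r m)) - C (x (r n)) = C d + (C (y m) - C (y n))"
        by (simp add: d_def C.diff)
      ultimately show ?thesis
        using N2[of m n] that norm_triangle_ineq[of "C d" "C (y m) - C (y n)"] by (simp add: dist_norm)
    qed
    then show "\<exists>M. \<forall>m\<ge>M. \<forall>n\<ge>M. dist (C (x (r m))) (C (x (r n))) < e" by blast
  qed
  then show thesis using that r Cauchy_convergent by blast
qed

text \<open>Points of the closure are replaced by images of unit ball vectors within
  \<open>1 / Suc n\<close>, which have a convergent subsequence; the vanishing error transfers its
  limit to the given sequence.\<close>

lemma ess_null_imp_compact_op:
  fixes C :: "'a::complex_inner \<Rightarrow> 'b::{complex_inner,complete_space}"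
  assumes "bounded_clinear C" "ess_null C"
  shows "compact_op C"
  unfolding compact_op_def compact_eq_seq_compact_metric seq_compact_def
proof (intro allI impI)
  fix f :: "nat \<Rightarrow> 'b" assume f: "\<forall>n. f n \<in> closure (C ` cball 0 1)"
  have "\<exists>x. norm x \<le> 1 \<and> dist (C x) (f n) < inverse (real (Suc n))" for n
    using f[rule_format, of n] unfolding closure_approachable
    by (force dest: spec[of _ "inverse (real (Suc n))"])
  then obtain x where x: "\<And>n. norm (x n) \<le> 1" "\<And>n. dist (C (x n)) (f n) < inverse (real (Suc n))"
    by metis
  obtain r where r: "strict_mono r" "convergent (\<lambda>n. C (x (r n)))"
    using ess_null_convergent_subseq[where x = x, OF assms x(1)] by blast
  then obtain l where l: "(\<lambda>n. C (x (r n))) \<longlonglongrightarrow> l" by (auto simp: convergent_def)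
  have "(\<lambda>n. dist (C (x n)) (f n)) \<longlonglongrightarrow> 0"
    using x(2) by (intro tendsto_sandwich[OF _ _ tendsto_const LIMSEQ_inverse_real_of_nat])
      (auto intro!: always_eventually less_imp_le)
  then have "(\<lambda>n. dist (C (x (r n))) (f (r n))) \<longlonglongrightarrow> 0"
    using LIMSEQ_subseq_LIMSEQ[OF _ r(1)] by (fastforce simp: o_def)
  then have fl: "(f \<circ> r) \<longlonglongrightarrow> l"
    using Lim_transform[OF l, of "\<lambda>n. f (r n)"]
    by (simp add: o_def dist_norm norm_minus_commute tendsto_norm_zero_iff)
  then have "l \<in> closure (C ` cball 0 1)"
    using f by (intro closed_sequentially[OF closed_closure _ fl]) auto
  then show "\<exists>l\<in>closure (C ` cball 0 1). \<exists>r. strict_mono r \<and> (f \<circ> r) \<longlonglongrightarrow> l"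
    using r fl by blast
qed

subsection \<open>Absolutely minimum attaining operators\<close>

lemma min_modulus_on_le:
  assumes "x \<in> M" "norm x = 1"
  shows "min_modulus_on S M \<le> norm (S x)"
  unfolding min_modulus_on_def
proof (rule cInf_lower)
  show "norm (S x) \<in> {norm (S x) | x. x \<in> M \<and> norm x = 1}" using assms by blast
  show "bdd_below {norm (S x) | x. x \<in> M \<and> norm x = 1}" by (rule bdd_belowI[of _ 0]) auto
qed

lemma normalize_in_csubspace:
  assumes "csubspace M" "x \<in> M" "x \<noteq> 0"
  shows "scaleR (1 / norm x) x \<in> M" "norm (scaleR (1 / norm x) x) = 1"
  using assms by (auto intro: csubspace_scaleR)

lemma min_modulus_on_le_norm:
  assumes "bounded_clinear S" "csubspace M" "x \<in> M"
  shows "min_modulus_on S M * norm x \<le> norm (S x)"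
proof (cases "x = 0")
  case False
  interpret bounded_linear S by (rule bounded_clinear_imp_bounded_linear[OF assms(1)])
  show ?thesis
    using min_modulus_on_le[OF normalize_in_csubspace[OF assms(2,3) False], of S] False
    by (simp add: scaleR field_simps)
qed simp

lemma min_modulus_on_approx:
  assumes "csubspace M" "M \<noteq> {0}" "0 < e"
  shows "\<exists>x\<in>M. norm x = 1 \<and> norm (S x) < min_modulus_on S M + e"
proof -
  have "\<exists>x\<in>M. x \<noteq> 0" using assms by (auto simp: csubspace_def)
  then obtain x where "x \<in> M" "norm x = 1" using normalize_in_csubspace[OF assms(1)] by metis
  then have "{norm (S x) | x. x \<in> M \<and> norm x = 1} \<noteq> {}" by blast
  from cInf_lessD[OF this, of "min_modulus_on S M + e"] assms(3) show ?thesis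
    by (auto simp: min_modulus_on_def)
qed

lemma min_modulus_on_nonneg:
  assumes "csubspace M" "M \<noteq> {0}"
  shows "0 \<le> min_modulus_on S M"
proof (rule field_le_epsilon)
  fix e :: real assume "0 < e"
  from min_modulus_on_approx[OF assms this, of S] obtain x where "norm (S x) < min_modulus_on S M + e"
    by blast
  then show "0 \<le> min_modulus_on S M + e"
    using norm_ge_zero[of "S x"] by linarith
qed

text \<open>A minimising sequence is compact if the minimum modulus is below \<open>\<beta>\<close>: by the parallelogram law
  its differences \<open>d\<close> almost satisfy \<open>\<parallel>A d\<parallel> \<le> m \<parallel>d\<parallel>\<close>, while \<open>\<parallel>A d\<parallel>\<close> is close to \<open>\<beta> \<parallel>d\<parallel>\<close>.\<close>

lemma abs_min_attaining_of_ess_null: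
  fixes A :: "'a::{complex_inner,complete_space} \<Rightarrow> 'a"
  assumes bc: "bounded_clinear A" and \<beta>: "0 \<le> \<beta>"
    and null: "ess_null (\<lambda>x. A x - scaleR \<beta> x)"
    and G0: "finite G0" "\<And>y. y \<in> orth G0 \<Longrightarrow> norm (A y) \<le> \<beta> * norm y"
  shows "abs_min_attaining A"
  unfolding abs_min_attaining_def closed_csubspace_def
proof (intro allI impI; elim conjE)
  fix M :: "'a set" assume M: "csubspace M" "closed M" "M \<noteq> {0}"
  interpret A: bounded_linear A by (rule bounded_clinear_imp_bounded_linear[OF bc])
  have bc': "bounded_clinear (\<lambda>x. A x - scaleR \<beta> x)"
    using bounded_clinear_add_scaleC[OF bc, of "complex_of_real (- \<beta>)"]
    unfolding scaleR_scaleC[symmetric] by simp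
  define m where "m = min_modulus_on A M"
  have m0: "0 \<le> m" unfolding m_def using M by (intro min_modulus_on_nonneg)
  have mle: "m * norm x \<le> norm (A x)" if "x \<in> M" for x
    unfolding m_def using bc M(1) that by (rule min_modulus_on_le_norm)
  have "\<exists>x\<in>M. norm x = 1 \<and> norm (A x) < m + inverse (real (Suc n))" for n
    unfolding m_def using M by (intro min_modulus_on_approx) auto
  then obtain x where xM: "\<And>n. x n \<in> M" and x1: "\<And>n. norm (x n) = 1"
    and xm: "\<And>n. norm (A (x n)) < m + inverse (real (Suc n))" by metis
  have lim: "(\<lambda>n. norm (A (x n))) \<longlonglongrightarrow> m"
  proof (rule tendsto_sandwich[OF _ _ tendsto_const LIMSEQ_inverse_real_of_nat_add])
    show "\<forall>\<^sub>F n in sequentially. m \<le> norm (A (x n))" using mle[OF xM] x1 by simp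
  qed (use xm in \<open>auto intro!: always_eventually less_imp_le\<close>)
  \<comment> \<open>By continuity and closedness of \<open>M\<close>, it is enough that some
    subsequence of the minimising sequence converges.\<close>
  have attained: "min_attaining_on A M" if r: "strict_mono r" "convergent (\<lambda>n. x (r n))" for r
  proof -
    obtain l where l: "(\<lambda>n. x (r n)) \<longlonglongrightarrow> l" using r by (auto simp: convergent_def)
    have "l \<in> M" using closed_sequentially[OF M(2) _ l] xM by blast
    moreover have "norm l = 1" using tendsto_norm[OF l] x1 by (simp add: LIMSEQ_const_iff)
    moreover have "norm (A l) = m"
      using LIMSEQ_unique[OF tendsto_norm[OF A.tendsto[OF l]]] LIMSEQ_subseq_LIMSEQ[OF lim r(1)]
      by (simp add: o_def)
    ultimately show ?thesis by (auto simp: min_attaining_on_def m_def)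
  qed
  show "min_attaining_on A M"
  \<comment> \<open>A trivial intersection makes \<open>M\<close> finite dimensional, and
    convergence of the finitely many coordinates suffices. Otherwise a unit vector of the
    intersection shows that the minimum modulus is at most \<open>\<beta>\<close>.\<close>
  proof (cases "M \<inter> orth G0 = {0}")
    case True
    obtain u where u: "\<And>y. y \<in> M \<Longrightarrow> y - (\<Sum>g\<in>G0. scaleC (cinner g y) (u g)) \<in> orth G0"
      and uM: "\<And>g. g \<in> G0 \<Longrightarrow> u g \<in> M"
      using biorthogonal_system[OF G0(1) M(1)] by auto
    obtain r where r: "strict_mono r" "\<And>g. g \<in> G0 \<Longrightarrow> convergent (\<lambda>n. cinner g (x (r n)))"
      using weak_convergent_subseq[OF countable_finite[OF G0(1)], of x 1] x1 by auto
    then obtain l where l: "\<And>g. g \<in> G0 \<Longrightarrow> (\<lambda>n. cinner g (x (r n))) \<longlonglongrightarrow> l g"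
      unfolding convergent_def by metis
    have "x (r n) = (\<Sum>g\<in>G0. scaleC (cinner g (x (r n))) (u g))" for n
    proof -
      have "x (r n) - (\<Sum>g\<in>G0. scaleC (cinner g (x (r n))) (u g)) \<in> M"
        by (intro csubspace_diff csubspace_sum M(1) xM) (use M(1) uM in \<open>simp add: csubspace_def\<close>)
      then have "x (r n) - (\<Sum>g\<in>G0. scaleC (cinner g (x (r n))) (u g)) \<in> M \<inter> orth G0"
        using u[OF xM] by simp
      then show ?thesis unfolding True by simp
    qed
    moreover have "(\<lambda>n. \<Sum>g\<in>G0. scaleC (cinner g (x (r n))) (u g)) \<longlonglongrightarrow> (\<Sum>g\<in>G0. scaleC (l g) (u g))"
      by (intro tendsto_sum bounded_linear.tendsto[OF scaleC_left_linear] l)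
    ultimately have "(\<lambda>n. x (r n)) \<longlonglongrightarrow> (\<Sum>g\<in>G0. scaleC (l g) (u g))" by simp
    then show ?thesis using attained r convergentI by blast
  next
    case False
    have sub: "csubspace (M \<inter> orth G0)" using M(1) csubspace_orth by (rule csubspace_Int)
    then have "\<exists>y \<in> M \<inter> orth G0. y \<noteq> 0" using False by (auto simp: csubspace_def)
    then obtain y where y: "y \<in> M \<inter> orth G0" "norm y = 1" using normalize_in_csubspace[OF sub] by metis
    then have y\<beta>: "norm (A y) \<le> \<beta>" and my: "m \<le> norm (A y)" using G0(2)[of y] mle[of y] by auto
    show ?thesis
    proof (cases "m = \<beta>")
      case True
      then show ?thesis using y y\<beta> my by (auto simp: min_attaining_on_def m_def intro!: bexI[of _ y])
    next
      case False
      then have m\<beta>: "m < \<beta>" using y\<beta> my by simp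
      obtain r where r: "strict_mono r" "convergent (\<lambda>n. A (x (r n)) - scaleR \<beta> (x (r n)))"
        using ess_null_convergent_subseq[OF bc' null, of x 1] x1 by auto
      define z where "z n = x (r n)" for n
      define C where "C n = A (z n) - scaleR \<beta> (z n)" for n
      obtain K where K: "0 < K" "\<And>v. norm (A v) \<le> norm v * K" using A.pos_bounded by blast
      \<comment> \<open>The lower bound \<open>m\<close> applied to \<open>z i + z j\<close>, with
        the parallelogram law for both vectors and images, bounds \<open>norm (A d)\<close> from
        above. The identity \<open>scaleR \<beta> d = A d - c\<close> bounds it from below; the sum
        of the two isolates \<open>norm d\<close>.\<close>
      have est: "(\<beta>\<^sup>2 - m\<^sup>2) * (norm (z i - z j))\<^sup>2
          \<le> 2 * ((norm (A (z i)))\<^sup>2 - m\<^sup>2) + 2 * ((norm (A (z j)))\<^sup>2 - m\<^sup>2)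
            + norm (C i - C j) * (4 * K + norm (C i - C j))" for i j
      proof -
        define d c where "d = z i - z j" and "c = C i - C j"
        have nz: "norm (z n) = 1" "z n \<in> M" for n by (simp_all add: z_def x1 xM)
        have s: "(norm (z i + z j))\<^sup>2 = 4 - (norm d)\<^sup>2"
          using parallelogram[of "z i" "z j"] by (simp add: d_def nz)
        have "m * norm (z i + z j) \<le> norm (A (z i + z j))"
          using M(1) nz by (intro mle) (simp add: csubspace_def)
        then have "(m * norm (z i + z j))\<^sup>2 \<le> (norm (A (z i + z j)))\<^sup>2"
          using m0 by (intro power_mono) auto
        then have 1: "m\<^sup>2 * (4 - (norm d)\<^sup>2) \<le> (norm (A (z i + z j)))\<^sup>2"
          by (simp add: power_mult_distrib s)
        have 2: "(norm (A d))\<^sup>2 + (norm (A (z i + z j)))\<^sup>2 = 2 * (norm (A (z i)))\<^sup>2 + 2 * (norm (A (z j)))\<^sup>2"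
          unfolding d_def A.diff A.add by (rule parallelogram)
        have "norm d \<le> 2" unfolding d_def using norm_triangle_ineq4[of "z i" "z j"] by (simp add: nz)
        then have Ad: "norm (A d) \<le> 2 * K"
          using K(2)[of d] mult_right_mono[of "norm d" 2 K] K(1) by linarith
        have "scaleR \<beta> d = A d - c" by (simp add: d_def c_def C_def scaleR_diff_right A.diff)
        then have "\<beta> * norm d \<le> norm (A d) + norm c"
          using norm_triangle_ineq4[of "A d" c] \<beta> by (metis norm_scaleR abs_of_nonneg)
        then have "(\<beta> * norm d)\<^sup>2 \<le> (norm (A d) + norm c)\<^sup>2"
          using \<beta> by (intro power_mono) auto
        also have "\<dots> = (norm (A d))\<^sup>2 + norm c * (2 * norm (A d) + norm c)"
          by (simp add: power2_eq_square algebra_simps)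
        also have "\<dots> \<le> (norm (A d))\<^sup>2 + norm c * (4 * K + norm c)"
          using Ad by (intro add_left_mono mult_left_mono) auto
        finally show ?thesis using 1 2
          unfolding d_def[symmetric] c_def[symmetric] by (simp add: power_mult_distrib algebra_simps)
      qed
      have "Cauchy z"
      proof (rule metric_CauchyI)
        fix e :: real assume e: "0 < e"
        define h where "h = (\<beta>\<^sup>2 - m\<^sup>2) * e\<^sup>2"
        have bm: "0 < \<beta>\<^sup>2 - m\<^sup>2" using m\<beta> m0 by (simp add: power_strict_mono)
        then have h: "0 < h" using e by (simp add: h_def)
        have "(\<lambda>n. 4 * ((norm (A (z n)))\<^sup>2 - m\<^sup>2)) \<longlonglongrightarrow> 4 * (m\<^sup>2 - m\<^sup>2)"
          using LIMSEQ_subseq_LIMSEQ[OF lim r(1)] unfolding z_def o_def by (intro tendsto_intros)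
        then have "\<forall>\<^sub>F n in sequentially. 4 * ((norm (A (z n)))\<^sup>2 - m\<^sup>2) < h / 2"
          using h by (intro order_tendstoD(2)) auto
        then obtain N1 where N1: "\<And>n. n \<ge> N1 \<Longrightarrow> 4 * ((norm (A (z n)))\<^sup>2 - m\<^sup>2) < h / 2"
          by (auto simp: eventually_sequentially)
        \<comment> \<open>The bound 1 allows \<open>4 * K + norm (C i - C j)\<close> to be replaced
          by \<open>4 * K + 1\<close>; the other bound then makes the error product at most
          \<open>h / 2\<close>.\<close>
        define g where "g = min 1 (h / (2 * (4 * K + 1)))"
        have g: "0 < g" using h K by (simp add: g_def)
        have "Cauchy C" unfolding C_def z_def using r convergent_Cauchy by blast
        then obtain N2 where N2: "\<And>i j. i \<ge> N2 \<Longrightarrow> j \<ge> N2 \<Longrightarrow> norm (C i - C j) < g"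
          using g by (metis CauchyD)
        have "dist (z i) (z j) < e" if "i \<ge> max N1 N2" "j \<ge> max N1 N2" for i j
        proof -
          have c: "norm (C i - C j) < g" using that N2 by simp
          then have "norm (C i - C j) * (4 * K + norm (C i - C j)) \<le> g * (4 * K + 1)"
            using K g by (intro mult_mono) (auto simp: g_def)
          also have "\<dots> \<le> h / (2 * (4 * K + 1)) * (4 * K + 1)"
            using K by (intro mult_right_mono) (auto simp: g_def)
          also have "\<dots> = h / 2" using K by (simp add: field_simps)
          finally have "(\<beta>\<^sup>2 - m\<^sup>2) * (norm (z i - z j))\<^sup>2 < (\<beta>\<^sup>2 - m\<^sup>2) * e\<^sup>2"
            using est[of i j] N1[of i] N1[of j] that unfolding h_def by simp
          then have "(norm (z i - z j))\<^sup>2 < e\<^sup>2" using bm by simp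
          then show ?thesis using e by (simp add: dist_norm power2_less_imp_less)
        qed
        then show "\<exists>M. \<forall>i\<ge>M. \<forall>j\<ge>M. dist (z i) (z j) < e" by blast
      qed
      then have "convergent (\<lambda>n. x (r n))" unfolding z_def using Cauchy_convergent by blast
      then show ?thesis using attained r(1) by blast
    qed
  qed
qed

subsection \<open>The essential spectrum\<close>

text \<open>Infinite dimension in the form used below: a vector outside the finite dimensional span
  of the correction vectors leaves a nonzero remainder in \<open>orth G\<close>, which can be
  normalised.\<close>

lemma unit_vector_in_orth:
  assumes inf: "\<And>F::'a::complex_inner set. finite F \<Longrightarrow> cspan F \<noteq> UNIV" and G: "finite (G::'a set)"
  shows "\<exists>x\<in>orth G. norm x = 1"
proof -
  obtain u where u: "\<And>x. x - (\<Sum>g\<in>G. scaleC (cinner g x) (u g)) \<in> orth G"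
    using biorthogonal_system[OF G csubspace_UNIV] by auto
  have span: "(\<Sum>g\<in>G. scaleC (cinner g x) (u g)) \<in> cspan (u ` G)" for x
    using csubspace_cspan[of "u ` G"] cspan_superset[of "u ` G"]
    by (intro csubspace_sum csubspace_cspan) (auto simp: csubspace_def)
  obtain x where "x \<notin> cspan (u ` G)" using inf[of "u ` G"] G by blast
  then have "x - (\<Sum>g\<in>G. scaleC (cinner g x) (u g)) \<noteq> 0" using span[of x] by auto
  then show ?thesis using normalize_in_csubspace[OF csubspace_orth u[of x]] by blast
qed

text \<open>A greedy choice under accumulating finite constraints. The parameter \<open>h\<close>
  serves both plain orthogonality, with \<open>{x}\<close>, and orthogonality of the images as well,
  with \<open>{x, T (T x)}\<close>.\<close>

lemma orthogonal_sequence: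
  fixes P :: "nat \<Rightarrow> 'a::complex_inner \<Rightarrow> bool"
  assumes ex: "\<And>n G. finite G \<Longrightarrow> \<exists>x\<in>orth G. P n x" and h: "\<And>x. finite (h x)"
  obtains e where "\<And>n. P n (e n)" "\<And>m n. m < n \<Longrightarrow> e n \<in> orth (h (e m))"
proof -
  \<comment> \<open>The recursion state pairs the current vector with all constraints imposed by the
    earlier ones.\<close>
  have "\<exists>f. \<forall>n. (P n (fst (f n)) \<and> finite (snd (f n))) \<and>
      (fst (f (Suc n)) \<in> orth (h (fst (f n)) \<union> snd (f n)) \<and> snd (f (Suc n)) = h (fst (f n)) \<union> snd (f n))"
  proof (rule dependent_nat_choice)
    show "\<exists>x. P 0 (fst x) \<and> finite (snd x)" using ex[of "{}" 0] by force
  next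
    fix n and x :: "'a \<times> 'a set" assume "P n (fst x) \<and> finite (snd x)"
    then have fin: "finite (h (fst x) \<union> snd x)" using h by simp
    then obtain y where "y \<in> orth (h (fst x) \<union> snd x)" "P (Suc n) y" using ex by blast
    with fin show "\<exists>y. (P (Suc n) (fst y) \<and> finite (snd y)) \<and>
        (fst y \<in> orth (h (fst x) \<union> snd x) \<and> snd y = h (fst x) \<union> snd x)"
      by (intro exI[of _ "(y, h (fst x) \<union> snd x)"]) simp
  qed
  then obtain f where f: "\<And>n. P n (fst (f n))"
    "\<And>n. fst (f (Suc n)) \<in> orth (h (fst (f n)) \<union> snd (f n))"
    "\<And>n. snd (f (Suc n)) = h (fst (f n)) \<union> snd (f n)" by blast
  have sub: "h (fst (f m)) \<subseteq> h (fst (f n)) \<union> snd (f n)" if "m \<le> n" for m n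
    using that by (induction rule: dec_induct) (auto simp: f(3))
  then have "fst (f n) \<in> orth (h (fst (f m)))" if "m < n" for m n
  proof (cases n)
    case (Suc k)
    then show ?thesis using f(2)[of k] orth_antimono[OF sub[of m k]] that by auto
  qed (use that in simp)
  then show thesis using that[of "\<lambda>n. fst (f n)"] f(1) by blast
qed

section \<open>Essentially null perturbations of scalar operators\<close>

text \<open>On the kernel \<open>C\<close> acts as \<open>- \<mu>\<close>, while on a suitable
  \<open>orth G\<close> its norm is at most half of \<open>cmod \<mu>\<close>. The two meet only in
  0, so the correction vectors for \<open>G\<close> inside the kernel span it.\<close>

lemma ess_null_kernel:
  assumes bc: "bounded_clinear C" and null: "ess_null C" and \<mu>: "\<mu> \<noteq> 0"
  shows "\<exists>F. finite F \<and> cspan F = {x. C x + scaleC \<mu> x = 0}"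
proof -
  let ?N = "{x. C x + scaleC \<mu> x = 0}"
  have N: "csubspace ?N"
  proof -
    interpret bounded_linear C by (rule bounded_clinear_imp_bounded_linear[OF bc])
    have "C (x + y) + scaleC \<mu> (x + y) = (C x + scaleC \<mu> x) + (C y + scaleC \<mu> y)" for x y
      by (simp add: add scaleC_add_right)
    moreover have "C (scaleC c x) + scaleC \<mu> (scaleC c x) = scaleC c (C x + scaleC \<mu> x)" for c x
      using bc by (simp add: bounded_clinear_def scaleC_add_right scaleC_scaleC mult.commute)
    ultimately show ?thesis by (simp add: csubspace_def zero scaleC_right_zero)
  qed
  obtain G where G: "finite G" "\<And>x. x \<in> orth G \<Longrightarrow> norm (C x) \<le> cmod \<mu> / 2 * norm x"
    using null \<mu> unfolding ess_null_def by (metis half_gt_zero zero_less_norm_iff)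
  obtain u where uN: "\<And>g. g \<in> G \<Longrightarrow> u g \<in> ?N"
    and u: "\<And>x. x \<in> ?N \<Longrightarrow> x - (\<Sum>g\<in>G. scaleC (cinner g x) (u g)) \<in> orth G"
    using biorthogonal_system[OF G(1) N] by blast
  have zero: "x = 0" if "x \<in> ?N" "x \<in> orth G" for x
  proof -
    have "C x = - scaleC \<mu> x" using that(1) by (simp add: eq_neg_iff_add_eq_0)
    then have "cmod \<mu> * norm x \<le> cmod \<mu> / 2 * norm x" using G(2)[OF that(2)] by (simp add: norm_scaleC)
    then show ?thesis using \<mu> by (simp add: mult_le_0_iff field_simps)
  qed
  have "cspan (u ` G) = ?N"
  proof
    show "cspan (u ` G) \<subseteq> ?N" using uN by (intro cspan_minimal N) auto
    show "?N \<subseteq> cspan (u ` G)"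
    proof
      fix x assume x: "x \<in> ?N"
      have "(\<Sum>g\<in>G. scaleC (cinner g x) (u g)) \<in> ?N"
        by (rule csubspace_sum[OF N]) (use N uN in \<open>simp add: csubspace_def\<close>)
      then have "x - (\<Sum>g\<in>G. scaleC (cinner g x) (u g)) = 0"
        using x u[OF x] by (intro zero csubspace_diff[OF N])
      then have "x = (\<Sum>g\<in>G. scaleC (cinner g x) (u g))" by simp
      also have "\<dots> \<in> cspan (u ` G)"
        using csubspace_cspan[of "u ` G"] cspan_superset[of "u ` G"]
        by (intro csubspace_sum csubspace_cspan) (auto simp: csubspace_def)
      finally show "x \<in> cspan (u ` G)" .
    qed
  qed
  then show ?thesis using G(1) by blast
qed

lemma kernel_closed:
  assumes "bounded_clinear B"
  shows "csubspace {x. B x = 0}" "closed {x. B x = 0}"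
proof -
  interpret bounded_linear B by (rule bounded_clinear_imp_bounded_linear[OF assms])
  show "csubspace {x. B x = 0}"
    using assms by (simp add: csubspace_def zero add bounded_clinear_scaleC scaleC_right_zero)
  show "closed {x. B x = 0}"
    by (intro closed_Collect_eq continuous_intros continuous_on)
qed

lemma csubspace_range:
  assumes "bounded_clinear B" shows "csubspace (range B)"
  unfolding csubspace_def
proof (intro conjI ballI allI)
  interpret bounded_linear B by (rule bounded_clinear_imp_bounded_linear[OF assms])
  show "0 \<in> range B" using zero by (metis rangeI)
  show "x + y \<in> range B" if "x \<in> range B" "y \<in> range B" for x y
    using that add by (auto simp flip: add)
  show "scaleC c x \<in> range B" if "x \<in> range B" for c x
    using that by (auto simp flip: bounded_clinear_scaleC[OF assms])
qed

text \<open>The operator is bounded below on the orthogonal complement of its kernel: otherwise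
  compactness would produce a unit vector lying in both. A map bounded below has complete image, and
  that image is the whole range.\<close>

lemma ess_null_closed_range:
  fixes C :: "'a::{complex_inner,complete_space} \<Rightarrow> 'a"
  assumes bc: "bounded_clinear C" and null: "ess_null C" and \<mu>: "\<mu> \<noteq> 0"
  shows "closed (range (\<lambda>x. C x + scaleC \<mu> x))"
proof -
  define B where "B x = C x + scaleC \<mu> x" for x
  have bcB: "bounded_clinear B" unfolding B_def by (rule bounded_clinear_add_scaleC[OF bc])
  interpret B: bounded_linear B by (rule bounded_clinear_imp_bounded_linear[OF bcB])
  let ?V = "orth {x. B x = 0}"
  have "\<exists>c>0. \<forall>x\<in>?V. c * norm x \<le> norm (B x)"
  proof (rule ccontr)
    assume neg: "\<not> ?thesis"
    have "\<exists>x\<in>?V. norm x = 1 \<and> norm (B x) < inverse (real (Suc n))" for n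
    proof -
      have "0 < inverse (real (Suc n))" by simp
      then obtain x where x: "x \<in> ?V" "norm (B x) < inverse (real (Suc n)) * norm x"
        using neg by (meson not_less)
      then have x0: "x \<noteq> 0" by auto
      have "norm (B (scaleR (1 / norm x) x)) < inverse (real (Suc n))"
        using x(2) x0 by (simp add: B.scaleR divide_less_eq)
      then show ?thesis using normalize_in_csubspace[OF csubspace_orth x(1) x0] by blast
    qed
    then obtain x where xV: "\<And>n. x n \<in> ?V" and x1: "\<And>n. norm (x n) = 1"
      and xB: "\<And>n. norm (B (x n)) < inverse (real (Suc n))" by metis
    have B0: "(\<lambda>n. B (x n)) \<longlonglongrightarrow> 0"
      by (rule tendsto_norm_zero_cancel, rule tendsto_sandwich[OF _ _ tendsto_const LIMSEQ_inverse_real_of_nat])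
        (use xB in \<open>auto intro!: always_eventually less_imp_le\<close>)
    obtain r where r: "strict_mono r" "convergent (\<lambda>n. C (x (r n)))"
      using ess_null_convergent_subseq[OF bc null, of x 1] x1 by auto
    then obtain w where w: "(\<lambda>n. C (x (r n))) \<longlonglongrightarrow> w" by (auto simp: convergent_def)
    \<comment> \<open>Since \<open>\<mu>\<close> is nonzero, \<open>x (r n)\<close> is recovered
      from \<open>B (x (r n))\<close> and \<open>C (x (r n))\<close>, both of which
      converge.\<close>
    have "(\<lambda>n. scaleC (1 / \<mu>) (B (x (r n)) - C (x (r n)))) \<longlonglongrightarrow> scaleC (1 / \<mu>) (0 - w)"
      using LIMSEQ_subseq_LIMSEQ[OF B0 r(1)]
      by (intro scaleC_right_tendsto tendsto_diff w) (simp add: o_def)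
    moreover have "scaleC (1 / \<mu>) (B (x (r n)) - C (x (r n))) = x (r n)" for n
      using \<mu> by (simp add: B_def scaleC_scaleC scaleC_one)
    ultimately obtain l where l: "(\<lambda>n. x (r n)) \<longlonglongrightarrow> l" by auto
    have lV: "l \<in> ?V" using closed_sequentially[OF closed_orth _ l] xV by blast
    have "norm l = 1" using tendsto_norm[OF l] x1 by (simp add: LIMSEQ_const_iff)
    moreover have "B l = 0"
      using LIMSEQ_unique[OF B.tendsto[OF l]] LIMSEQ_subseq_LIMSEQ[OF B0 r(1)] by (simp add: o_def)
    ultimately show False using lV cinner_eq_zero_iff[of l] by (auto simp: orth_def)
  qed
  then obtain c where c: "0 < c" "\<And>x. x \<in> ?V \<Longrightarrow> c * norm x \<le> norm (B x)" by blast
  have "complete (B ` ?V)"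
    using c by (intro complete_isometric_image[of c] csubspace_imp_subspace csubspace_orth B.bounded_linear_axioms)
      (auto simp: complete_eq_closed closed_orth)
  moreover have "range B = B ` ?V"
  proof
    show "range B \<subseteq> B ` ?V"
    proof (rule image_subsetI)
      fix x
      obtain p where p: "B p = 0" "x - p \<in> ?V"
        using projection_exists[OF kernel_closed[OF bcB], of x] by blast
      have "B x = B (x - p)" by (simp add: B.diff p)
      then show "B x \<in> B ` ?V" using p(2) by blast
    qed
  qed auto
  ultimately show ?thesis using complete_imp_closed unfolding B_def by metis
qed

text \<open>The adjoint of \<open>C + \<mu>\<close> is \<open>C + cnj \<mu>\<close> by symmetry. The
  orthogonal complement of the closed range lies in its kernel, so the kernel lemma bounds the
  cokernel too.\<close>

lemma ess_null_fredholm: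
  fixes C :: "'a::{complex_inner,complete_space} \<Rightarrow> 'a"
  assumes bc: "bounded_clinear C" and null: "ess_null C" and \<mu>: "\<mu> \<noteq> 0"
    and sym: "\<And>x y. cinner (C x) y = cinner x (C y)"
  shows "fredholm (\<lambda>x. C x + scaleC \<mu> x)"
proof -
  define R where "R = range (\<lambda>x. C x + scaleC \<mu> x)"
  have bcB: "bounded_clinear (\<lambda>x. C x + scaleC \<mu> x)" by (rule bounded_clinear_add_scaleC[OF bc])
  have R: "csubspace R" "closed R"
    unfolding R_def using csubspace_range[OF bcB] ess_null_closed_range[OF bc null \<mu>] by auto
  obtain F where F: "finite F" "cspan F = {x. C x + scaleC (cnj \<mu>) x = 0}"
    using ess_null_kernel[OF bc null, of "cnj \<mu>"] \<mu> by auto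
  have "orth R \<subseteq> cspan F"
  proof
    fix y assume "y \<in> orth R"
    then have "cinner (C x + scaleC \<mu> x) y = 0" for x by (auto simp: orth_def R_def)
    then have "cinner x (C y + scaleC (cnj \<mu>) y) = 0" for x
      by (simp add: cinner_add_left cinner_add_right cinner_scaleC_left cinner_scaleC_right sym)
    from this[of "C y + scaleC (cnj \<mu>) y"] show "y \<in> cspan F"
      unfolding F(2) by (simp add: cinner_eq_zero_iff)
  qed
  have "cspan (R \<union> F) = UNIV"
  proof (rule UNIV_eq_I[symmetric])
    fix x
    obtain p where p: "p \<in> R" "x - p \<in> orth R" using projection_exists[OF R] by blast
    have "cspan F \<subseteq> cspan (R \<union> F)"
      using cspan_superset[of "R \<union> F"] by (intro cspan_minimal csubspace_cspan) auto
    then have "p \<in> cspan (R \<union> F)" "x - p \<in> cspan (R \<union> F)"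
      using p \<open>orth R \<subseteq> cspan F\<close> cspan_superset[of "R \<union> F"] by auto
    then have "p + (x - p) \<in> cspan (R \<union> F)"
      using csubspace_cspan[of "R \<union> F"] unfolding csubspace_def by blast
    then show "x \<in> cspan (R \<union> F)" by simp
  qed
  then show ?thesis
    unfolding fredholm_def using R(2) F(1) ess_null_kernel[OF bc null \<mu>] unfolding R_def by blast
qed

text \<open>If \<open>e k\<close> is orthonormal in the closure of the range and \<open>\<parallel>C (e k)\<parallel> \<le> 4^-k\<close>, then
  \<open>\<Sum>k. 2^-k e k\<close> is not in the range, which therefore is not closed.\<close>

lemma ess_null_not_fredholm:
  fixes C :: "'a::{complex_inner,complete_space} \<Rightarrow> 'a"
  assumes bc: "bounded_clinear C" and null: "ess_null C"
    and sym: "\<And>x y. cinner (C x) y = cinner x (C y)"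
    and inf: "\<And>G::'a set. finite G \<Longrightarrow> \<exists>x\<in>orth G. norm x = 1"
  shows "\<not> fredholm C"
proof
  assume "fredholm C"
  then obtain U where cl: "closed (range C)" and U: "finite U" "cspan U = {x. C x = 0}"
    unfolding fredholm_def by blast
  \<comment> \<open>By symmetry, the complement of the range is contained in the kernel. Closedness
    of the range therefore puts every vector orthogonal to the kernel into the range.\<close>
  have ranU: "y \<in> range C" if y: "y \<in> orth U" for y
  proof -
    obtain p where p: "p \<in> range C" "y - p \<in> orth (range C)"
      using projection_exists[OF csubspace_range[OF bc] cl] by blast
    define q where "q = y - p"
    have "cinner x (C q) = 0" for x
      using p(2) unfolding sym[symmetric] by (simp add: orth_def q_def)
    from this[of "C q"] have "q \<in> cspan U" unfolding U(2) by (simp add: cinner_eq_zero_iff)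
    then have "cinner q y = 0" using y unfolding orth_cspan[of U, symmetric] by (auto simp: orth_def)
    moreover have "cinner q p = 0" using p by (auto simp: orth_def q_def cinner_eq_0_commute)
    ultimately have "cinner q q = 0" by (simp add: q_def cinner.diff_right)
    then show ?thesis using p(1) by (simp add: cinner_eq_zero_iff q_def)
  qed
  define P where "P n x \<longleftrightarrow> x \<in> orth U \<and> norm x = 1 \<and> norm (C x) \<le> (1/4)^n" for n :: nat and x
  have "\<exists>x\<in>orth G. P n x" if "finite G" for n G
  proof -
    have pos: "(0::real) < (1/4)^n" by simp
    then obtain H where H: "finite H" "\<And>x. x \<in> orth H \<Longrightarrow> norm (C x) \<le> (1/4)^n * norm x"
      using null[unfolded ess_null_def, rule_format, OF pos] by blast
    have fin: "finite (G \<union> (U \<union> H))" using U(1) H(1) that by simp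
    obtain x where x: "x \<in> orth (G \<union> (U \<union> H))" "norm x = 1"
      using inf[OF fin] by (elim bexE)
    then show ?thesis using H(2)[of x] by (auto simp: orth_Un P_def)
  qed
  then obtain e where e: "\<And>n. P n (e n)" and eo: "\<And>m n. m < n \<Longrightarrow> e n \<in> orth {e m}"
    using orthogonal_sequence[of P "\<lambda>x. {x}"] by blast
  have ee: "cinner (e k) (e j) = (if j = k then 1 else 0)" for j k
    using eo[of k j] eo[of j k] e[of k] cinner_eq_0_commute[of "e j" "e k"]
    by (cases j k rule: linorder_cases) (auto simp: orth_def P_def cinner_self)
  define s where "s n = (\<Sum>k<n. scaleR ((1/2)^k) (e k))" for n
  \<comment> \<open>The bound is the exact sum of the added coefficients; keeping its subtracted
    term makes the induction close.\<close>
  have step: "norm (s (m + j) - s m) \<le> 2 * (1/2)^m - 2 * (1/2)^(m + j)" for m j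
  proof (induction j)
    case (Suc j)
    have "norm (s (m + Suc j) - s m) = norm ((s (m + j) - s m) + scaleR ((1/2)^(m + j)) (e (m + j)))"
      by (simp add: s_def algebra_simps)
    also have "\<dots> \<le> norm (s (m + j) - s m) + (1/2)^(m + j)"
      using e[of "m + j"] norm_triangle_ineq[of "s (m + j) - s m" "scaleR ((1/2)^(m + j)) (e (m + j))"]
      by (simp add: P_def)
    finally show ?case using Suc.IH by simp
  qed simp
  have "Cauchy s"
  proof (rule CauchyI')
    fix \<epsilon> :: real assume "0 < \<epsilon>"
    then obtain M where M: "(1/2)^M < \<epsilon> / 2"
      using real_arch_pow_inv[of "\<epsilon> / 2" "1/2"] by auto
    have "dist (s m) (s n) < \<epsilon>" if "m \<ge> M" "m < n" for m n
    proof -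
      have "norm (s n - s m) \<le> 2 * (1/2)^m - 2 * (1/2)^n" using step[of m "n - m"] that by simp
      also have "\<dots> \<le> 2 * (1/2)^m" by simp
      also have "\<dots> \<le> 2 * (1/2)^M" using that by (intro mult_left_mono power_decreasing) auto
      finally show ?thesis using M by (simp add: dist_norm norm_minus_commute)
    qed
    then show "\<exists>M. \<forall>m\<ge>M. \<forall>n>m. dist (s m) (s n) < \<epsilon>" by blast
  qed
  then obtain y where y: "s \<longlonglongrightarrow> y" using Cauchy_convergent convergent_def by blast
  have "s n \<in> orth U" for n
    unfolding s_def
    by (rule csubspace_sum[OF csubspace_orth], rule csubspace_scaleR[OF csubspace_orth])
      (use e in \<open>simp add: P_def\<close>)
  then have "y \<in> orth U" using closed_sequentially[OF closed_orth _ y] by blast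
  then obtain x where x: "y = C x" using ranU by blast
  have ey: "cinner (e k) y = (1/2)^k" for k
  proof -
    have "cinner (e k) (s n) = (1/2)^k" if "n \<ge> Suc k" for n
    proof -
      have "cinner (e k) (s n) = (\<Sum>j<n. if j = k then complex_of_real ((1/2)^k) else 0)"
        unfolding s_def cinner.sum_right by (intro sum.cong) (auto simp: cinner_scaleR_right ee)
      also have "\<dots> = complex_of_real ((1/2)^k)" using that by (subst sum.delta) auto
      finally show ?thesis by simp
    qed
    then have "\<forall>\<^sub>F n in sequentially. cinner (e k) (s n) = (1/2)^k"
      unfolding eventually_sequentially by blast
    then have "(\<lambda>n. cinner (e k) (s n)) \<longlonglongrightarrow> (1/2)^k" by (rule tendsto_eventually)
    then show ?thesis using LIMSEQ_unique cinner.tendsto[OF tendsto_const y] by blast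
  qed
  \<comment> \<open>Moving \<open>C\<close> to \<open>e k\<close> compares the coefficient
    \<open>(1/2)^k\<close> of \<open>y\<close> with the bound
    \<open>(1/4)^k * norm x\<close>.\<close>
  have "2^k \<le> norm x" for k
  proof -
    have "(1/2)^k = cmod (cinner (e k) y)" by (simp add: ey norm_power norm_divide)
    also have "\<dots> = cmod (cinner (C (e k)) x)" by (simp add: x sym)
    also have "\<dots> \<le> norm (C (e k)) * norm x" by (rule Cauchy_Schwarz)
    also have "\<dots> \<le> (1/4)^k * norm x" using e[of k] by (intro mult_right_mono) (auto simp: P_def)
    finally have "4^k * (1/2)^k \<le> norm x" by (simp add: power_divide field_simps)
    then show ?thesis by (simp add: power_mult_distrib[symmetric])
  qed
  then show False using real_arch_pow[of 2 "norm x"] by (meson not_le one_less_numeral_iff semiring_norm(76))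
qed

text \<open>With \<open>C = A - \<beta>\<close>, the operator \<open>A - l\<close> is
  \<open>C\<close> plus the scalar \<open>\<beta> - l\<close>: Fredholm when the scalar is nonzero,
  not Fredholm when it is zero.\<close>

lemma ess_spectrum_of_ess_null:
  fixes A :: "'a::{complex_inner,complete_space} \<Rightarrow> 'a"
  assumes bc: "bounded_clinear A" and sym: "\<And>x y. cinner (A x) y = cinner x (A y)"
    and null: "ess_null (\<lambda>x. A x - scaleR \<beta> x)"
    and inf: "\<And>G::'a set. finite G \<Longrightarrow> \<exists>x\<in>orth G. norm x = 1"
  shows "ess_spectrum A = {complex_of_real \<beta>}"
proof -
  define C where "C x = A x - scaleR \<beta> x" for x
  have bcC: "bounded_clinear C"
    using bounded_clinear_add_scaleC[OF bc, of "complex_of_real (- \<beta>)"]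
    unfolding scaleR_scaleC[symmetric] C_def by simp
  have symC: "cinner (C x) y = cinner x (C y)" for x y
    by (simp add: C_def cinner.diff_left cinner.diff_right cinner_scaleR_left cinner_scaleR_right sym)
  have nullC: "ess_null C" using null by (simp add: C_def[abs_def])
  have eq: "(\<lambda>x. A x - scaleC l x) = (\<lambda>x. C x + scaleC (complex_of_real \<beta> - l) x)" for l
    by (simp add: fun_eq_iff C_def scaleC_left_diff scaleR_scaleC)
  have "fredholm (\<lambda>x. A x - scaleC l x) \<longleftrightarrow> l \<noteq> complex_of_real \<beta>" for l
  proof (cases "l = complex_of_real \<beta>")
    case True
    then show ?thesis
      using ess_null_not_fredholm[OF bcC nullC symC inf] by (simp add: eq scaleC_left_zero)
  next
    case False
    then show ?thesis
      unfolding eq using ess_null_fredholm[OF bcC nullC _ symC, of "complex_of_real \<beta> - l"] by simp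
  qed
  then show ?thesis by (auto simp: ess_spectrum_def)
qed

subsection \<open>Positive absolutely minimum attaining operators\<close>

text \<open>Polarization: the defect \<open>h\<close> vanishes on the diagonal because the form is
  real, so it is antisymmetric. Replacing \<open>y\<close> by \<open>scaleC \<i> y\<close> makes it
  symmetric as well, hence zero.\<close>

lemma positive_op_symmetric:
  assumes "positive_op A"
  shows "cinner (A x) y = cinner x (A y)"
proof -
  have bc: "bounded_clinear A" and real: "cinner x (A x) \<in> \<real>" for x
    using assms by (auto simp: positive_op_def)
  interpret bounded_linear A by (rule bounded_clinear_imp_bounded_linear[OF bc])
  define h where "h x y = cinner x (A y) - cinner (A x) y" for x y
  have h0: "h x x = 0" for x
    using real[of x] cinner_commute[of "A x" x] by (simp add: h_def Reals_cnj_iff)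
  have "h (x + y) (x + y) = h x x + h y y + (h x y + h y x)" for x y
    by (simp add: h_def add cinner_add_left cinner_add_right)
  then have anti: "h x y + h y x = 0" for x y by (simp add: h0)
  have "h x (scaleC \<i> y) = \<i> * h x y" "h (scaleC \<i> y) x = - \<i> * h y x"
    by (simp_all add: h_def bounded_clinear_scaleC[OF bc] cinner_scaleC_left cinner_scaleC_right algebra_simps)
  with anti[of x "scaleC \<i> y"] have "\<i> * (h x y - h y x) = 0" by (simp add: algebra_simps)
  with anti[of x y] have "h x y = 0" by simp
  then show ?thesis by (simp add: h_def)
qed

lemma norm_sum_sq_orthogonal:
  fixes f :: "'b \<Rightarrow> 'a::complex_inner"
  assumes "finite F" "\<And>s t. s \<in> F \<Longrightarrow> t \<in> F \<Longrightarrow> s \<noteq> t \<Longrightarrow> cinner (f s) (f t) = 0"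
  shows "(norm (\<Sum>s\<in>F. f s))\<^sup>2 = (\<Sum>s\<in>F. (norm (f s))\<^sup>2)"
  using assms
proof (induction F)
  case (insert a F)
  have "cinner (f a) (\<Sum>s\<in>F. f s) = 0"
    unfolding cinner.sum_right using insert by (intro sum.neutral) auto
  then show ?case using insert by (simp add: norm_add_sq)
qed simp

text \<open>For a positive operator this is the least point of the essential spectrum.\<close>

definition ess_min_modulus :: "('a::complex_inner \<Rightarrow> 'b::complex_inner) \<Rightarrow> real" where
  "ess_min_modulus T = Sup {b. \<exists>G. finite G \<and> (\<forall>y\<in>orth G. b * norm y \<le> norm (T y))}"

context
  fixes T :: "'a::complex_inner \<Rightarrow> 'b::complex_inner"
  assumes bc: "bounded_clinear T"
    and inf: "\<And>G::'a set. finite G \<Longrightarrow> \<exists>x\<in>orth G. norm x = 1"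
begin

text \<open>Each \<open>orth G\<close> contains a unit vector, so any bound constant of
  \<open>T\<close> bounds the set.\<close>

lemma ess_min_modulus_bdd: "bdd_above {b. \<exists>G. finite G \<and> (\<forall>y\<in>orth G. b * norm y \<le> norm (T y))}"
proof -
  obtain K where K: "\<And>x. norm (T x) \<le> norm x * K" using bc by (auto simp: bounded_clinear_def)
  show ?thesis
  proof (rule bdd_aboveI[of _ K], clarify)
    fix b G assume G: "finite G" "\<forall>y\<in>orth G. b * norm y \<le> norm (T y)"
    obtain x where "x \<in> orth G" "norm x = 1" using inf[OF G(1)] by blast
    then show "b \<le> K" using G(2) K[of x] by force
  qed
qed

lemma ess_min_modulus_nonneg: "0 \<le> ess_min_modulus T"
  unfolding ess_min_modulus_def
  by (intro cSup_upper[OF _ ess_min_modulus_bdd]) (auto intro!: exI[of _ "{}"])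

lemma ess_min_modulus_lower:
  assumes "b < ess_min_modulus T"
  shows "\<exists>G. finite G \<and> (\<forall>y\<in>orth G. b * norm y \<le> norm (T y))"
proof -
  have "{b. \<exists>G. finite G \<and> (\<forall>y\<in>orth G. b * norm y \<le> norm (T y))} \<noteq> {}"
    by (intro ex_in_conv[THEN iffD1] exI[of _ 0] CollectI exI[of _ "{}"]) auto
  from less_cSupD[OF this assms[unfolded ess_min_modulus_def]]
  obtain c G where c: "b < c" "finite G" "\<forall>y\<in>orth G. c * norm y \<le> norm (T y)"
    by blast
  have "b * norm y \<le> norm (T y)" if "y \<in> orth G" for y
    using c(1,3) that mult_right_mono[of b c "norm y"] by fastforce
  then show ?thesis using c(2) by blast
qed

lemma ess_min_modulus_upper:
  assumes "ess_min_modulus T < b" "finite G"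
  shows "\<exists>x\<in>orth G. norm x = 1 \<and> norm (T x) < b"
proof (rule ccontr)
  interpret bounded_linear T by (rule bounded_clinear_imp_bounded_linear[OF bc])
  assume neg: "\<not> ?thesis"
  have "b * norm y \<le> norm (T y)" if y: "y \<in> orth G" for y
  proof (cases "y = 0")
    case False
    show ?thesis
      using neg normalize_in_csubspace[OF csubspace_orth y False] False
      by (force simp: scaleR field_simps not_less)
  qed simp
  then have "b \<le> ess_min_modulus T"
    unfolding ess_min_modulus_def using assms(2) by (intro cSup_upper[OF _ ess_min_modulus_bdd]) blast
  then show False using assms(1) by simp
qed

end

text \<open>If the bound failed on every \<open>orth G\<close>, an orthonormal sequence with
  orthogonal images could have image norms strictly above \<open>\<beta>\<close> and tending to it.
  On its closed span a minimiser would have image norm at most \<open>\<beta>\<close>, which forces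
  it to be orthogonal to the whole span.\<close>

lemma abs_min_attaining_ess_bound:
  fixes T :: "'a::complex_inner \<Rightarrow> 'a"
  assumes bc: "bounded_clinear T" and sym: "\<And>x y. cinner (T x) y = cinner x (T y)"
    and am: "abs_min_attaining T"
    and inf: "\<And>G::'a set. finite G \<Longrightarrow> \<exists>x\<in>orth G. norm x = 1"
  shows "\<exists>G. finite G \<and> (\<forall>y\<in>orth G. norm (T y) \<le> ess_min_modulus T * norm y)"
proof (rule ccontr)
  define \<beta> where "\<beta> = ess_min_modulus T"
  assume "\<not> ?thesis"
  then have neg: "\<exists>y\<in>orth G. \<beta> * norm y < norm (T y)" if "finite G" for G
    using that by (auto simp: \<beta>_def not_le)
  interpret T: bounded_linear T by (rule bounded_clinear_imp_bounded_linear[OF bc])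
  have \<beta>0: "0 \<le> \<beta>" unfolding \<beta>_def by (rule ess_min_modulus_nonneg[OF bc inf])
  define P where "P n x \<longleftrightarrow> norm x = 1 \<and> \<beta> < norm (T x) \<and> norm (T x) < \<beta> + inverse (real (Suc n))"
    for n :: nat and x
  have "\<exists>x\<in>orth G. P n x" if G: "finite G" for n G
  proof -
    define \<delta> where "\<delta> = inverse (real (Suc n))"
    have \<delta>: "0 < \<delta>" by (simp add: \<delta>_def)
    obtain f' where f': "f' \<in> orth G" "\<beta> * norm f' < norm (T f')" using neg[OF G] by blast
    then have f'0: "f' \<noteq> 0" by (auto simp: T.zero)
    define f where "f = scaleR (1 / norm f') f'"
    have f: "f \<in> orth G" "norm f = 1"
      unfolding f_def using normalize_in_csubspace[OF csubspace_orth f'(1) f'0] by auto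
    have fT: "\<beta> < norm (T f)" using f'(2) f'0 by (simp add: f_def T.scaleR field_simps)
    \<comment> \<open>Orthogonality to \<open>T (T f)\<close> becomes orthogonality of
      \<open>T f\<close> and \<open>T h\<close> by symmetry, so squared norms add for combinations
      of \<open>f\<close> and \<open>h\<close> and for their images.\<close>
    obtain h where h: "h \<in> orth (G \<union> {f, T (T f)})" "norm h = 1" "norm (T h) < \<beta> + \<delta>"
      using ess_min_modulus_upper[OF bc inf, of "\<beta> + \<delta>" "G \<union> {f, T (T f)}"] G \<delta> by (auto simp: \<beta>_def)
    have fh: "cinner f h = 0" "cinner (T f) (T h) = 0" "h \<in> orth G"
      using h(1) by (auto simp: orth_def sym[symmetric])
    show ?thesis
    proof (cases "\<beta> < norm (T h)")
      case True
      then show ?thesis using h fh by (auto simp: P_def \<delta>_def intro!: bexI[of _ h])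
    next
      case False
      \<comment> \<open>When the value at \<open>h\<close> is too low, \<open>f\<close> and
        \<open>h\<close> are mixed with weights \<open>sqrt r\<close> and
        \<open>sqrt (1 - r)\<close> to reach the squared value \<open>v\<close>. The minimum keeps
        \<open>v\<close> within reach of \<open>f\<close> and below the upper limit, still strictly
        above \<open>\<beta>\<^sup>2\<close>.\<close>
      define F H v where "F = (norm (T f))\<^sup>2" and "H = (norm (T h))\<^sup>2" and "v = min F ((\<beta> + \<delta> / 2)\<^sup>2)"
      have H: "H \<le> \<beta>\<^sup>2" unfolding H_def using False by (intro power_mono) auto
      have F: "\<beta>\<^sup>2 < F" unfolding F_def using fT \<beta>0 by (intro power_strict_mono) auto
      have "\<beta>\<^sup>2 < (\<beta> + \<delta> / 2)\<^sup>2" using \<beta>0 \<delta> by (intro power_strict_mono) auto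
      then have v: "\<beta>\<^sup>2 < v" "v \<le> F" using F by (auto simp: v_def)
      define r where "r = (v - H) / (F - H)"
      have r: "0 \<le> r" "r \<le> 1" using v H F by (auto simp: r_def divide_le_eq)
      have rv: "r * F + (1 - r) * H = v"
      proof -
        have "r * (F - H) = v - H" using H F by (simp add: r_def)
        then show ?thesis by (simp add: algebra_simps)
      qed
      define g where "g = scaleR (sqrt r) f + scaleR (sqrt (1 - r)) h"
      have "(norm g)\<^sup>2 = 1"
        using r f h fh by (simp add: g_def norm_add_sq cinner_scaleR_left cinner_scaleR_right power_mult_distrib)
      then have g1: "norm g = 1" by (metis norm_ge_zero power2_eq_1_iff neg_0_le_iff_le not_one_le_zero)
      have Tg: "(norm (T g))\<^sup>2 = v"
        unfolding rv[symmetric] using r fh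
        by (simp add: g_def T.add T.scaleR norm_add_sq cinner_scaleR_left cinner_scaleR_right
            power_mult_distrib F_def H_def)
      have "\<beta>\<^sup>2 < (norm (T g))\<^sup>2" unfolding Tg by (rule v(1))
      then have "\<beta> < norm (T g)" by (rule power2_less_imp_less) simp
      moreover have "(norm (T g))\<^sup>2 \<le> (\<beta> + \<delta> / 2)\<^sup>2" unfolding Tg v_def by (rule min.cobounded2)
      then have "norm (T g) \<le> \<beta> + \<delta> / 2" by (rule power2_le_imp_le) (use \<beta>0 \<delta> in simp)
      moreover have "g \<in> orth G"
        using f(1) fh(3) csubspace_orth[of G] csubspace_scaleR[OF csubspace_orth]
        unfolding g_def csubspace_def by blast
      ultimately show ?thesis
        unfolding P_def \<delta>_def[symmetric] using g1 \<delta> by (intro bexI[of _ g]) simp_all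
    qed
  qed
  then obtain g where g: "\<And>n. P n (g n)" and go: "\<And>m n. m < n \<Longrightarrow> g n \<in> orth {g m, T (T (g m))}"
    using orthogonal_sequence[of P "\<lambda>x. {x, T (T x)}"] by blast
  have gg: "cinner (g m) (g n) = 0 \<and> cinner (T (g m)) (T (g n)) = 0" if "m \<noteq> n" for m n
  proof -
    have "cinner (g i) (g j) = 0 \<and> cinner (T (g i)) (T (g j)) = 0" if "i < j" for i j
      using go[OF that] by (auto simp: orth_def sym[symmetric])
    then show ?thesis using that cinner_eq_0_commute by (metis linorder_neqE_nat)
  qed
  let ?S = "cspan (range g)"
  \<comment> \<open>On finite combinations the right side is a sum of nonnegative terms, one for
    each basis vector, and the left side is the term of \<open>g n\<close>. Both sides are
    continuous in \<open>z\<close>, so the inequality passes to the closure.\<close>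
  have key: "(cmod (cinner (g n) z))\<^sup>2 * ((norm (T (g n)))\<^sup>2 - \<beta>\<^sup>2) \<le> (norm (T z))\<^sup>2 - \<beta>\<^sup>2 * (norm z)\<^sup>2"
    if zS: "z \<in> ?S" for z n
  proof -
    obtain F c where F: "finite F" "F \<subseteq> range g" and z: "z = (\<Sum>s\<in>F. scaleC (c s) s)"
      using zS by (auto simp: cspan_def)
    have orth: "cinner s t = 0" "cinner (T s) (T t) = 0" if st: "s \<in> range g" "t \<in> range g" "s \<noteq> t" for s t
    proof -
      obtain i j where "s = g i" "t = g j" using st by blast
      then show "cinner s t = 0" "cinner (T s) (T t) = 0" using gg[of i j] st(3) by auto
    qed
    have s1: "norm s = 1" "\<beta>\<^sup>2 \<le> (norm (T s))\<^sup>2" if "s \<in> range g" for s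
      using that g \<beta>0 by (auto simp: P_def intro!: power_mono less_imp_le)
    have z2: "(norm z)\<^sup>2 = (\<Sum>s\<in>F. (cmod (c s))\<^sup>2)"
      unfolding z using F orth
      by (subst norm_sum_sq_orthogonal)
        (auto simp: cinner_scaleC_left cinner_scaleC_right norm_scaleC s1 subsetD intro!: sum.cong)
    have "T z = (\<Sum>s\<in>F. scaleC (c s) (T s))"
      unfolding z by (simp add: T.sum bounded_clinear_scaleC[OF bc])
    then have Tz2: "(norm (T z))\<^sup>2 = (\<Sum>s\<in>F. (cmod (c s))\<^sup>2 * (norm (T s))\<^sup>2)"
      using F orth
      by (simp, subst norm_sum_sq_orthogonal)
        (auto simp: cinner_scaleC_left cinner_scaleC_right norm_scaleC power_mult_distrib subsetD)
    have eq: "(norm (T z))\<^sup>2 - \<beta>\<^sup>2 * (norm z)\<^sup>2 = (\<Sum>s\<in>F. (cmod (c s))\<^sup>2 * ((norm (T s))\<^sup>2 - \<beta>\<^sup>2))"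
      unfolding Tz2 z2 by (simp add: sum_distrib_left sum_subtractf right_diff_distrib mult.commute)
    have nonneg: "0 \<le> (cmod (c s))\<^sup>2 * ((norm (T s))\<^sup>2 - \<beta>\<^sup>2)" if "s \<in> F" for s
      using that F s1 by (intro mult_nonneg_nonneg) auto
    have gz: "cinner (g n) z = (\<Sum>s\<in>F. if s = g n then c s else 0)"
      unfolding z cinner.sum_right
    proof (intro sum.cong refl)
      fix s assume "s \<in> F"
      then have "s \<in> range g" using F by blast
      then show "cinner (g n) (scaleC (c s) s) = (if s = g n then c s else 0)"
        using orth(1)[of "g n" s] s1(1) by (auto simp: cinner_scaleC_right cinner_self)
    qed
    show ?thesis
    proof (cases "g n \<in> F")
      case True
      then have "cinner (g n) z = c (g n)" using F(1) by (simp add: gz)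
      then show ?thesis
        unfolding eq using member_le_sum[OF True, of "\<lambda>s. (cmod (c s))\<^sup>2 * ((norm (T s))\<^sup>2 - \<beta>\<^sup>2)"] nonneg F(1)
        by simp
    next
      case False
      then have "cinner (g n) z = 0" unfolding gz by (intro sum.neutral) auto
      then show ?thesis unfolding eq using nonneg by (simp add: sum_nonneg)
    qed
  qed
  define M where "M = closure ?S"
  have contT: "continuous_on UNIV T" by (rule T.continuous_on[OF continuous_on_id])
  have keyM: "(cmod (cinner (g n) z))\<^sup>2 * ((norm (T (g n)))\<^sup>2 - \<beta>\<^sup>2) \<le> (norm (T z))\<^sup>2 - \<beta>\<^sup>2 * (norm z)\<^sup>2"
    if "z \<in> M" for z n
  proof -
    have "M \<subseteq> {z. (cmod (cinner (g n) z))\<^sup>2 * ((norm (T (g n)))\<^sup>2 - \<beta>\<^sup>2) \<le> (norm (T z))\<^sup>2 - \<beta>\<^sup>2 * (norm z)\<^sup>2}"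
      unfolding M_def
      by (rule closure_minimal) (use key in \<open>auto intro!: closed_Collect_le continuous_intros
        cinner.continuous_on T.continuous_on\<close>)
    then show ?thesis using that by blast
  qed
  have gM: "g n \<in> M" for n
    unfolding M_def by (intro subsetD[OF closure_subset] subsetD[OF cspan_superset] rangeI)
  have M: "closed_csubspace M"
    unfolding M_def closed_csubspace_def by (simp add: csubspace_closure csubspace_cspan)
  moreover have "M \<noteq> {0}" using gM[of 0] g[of 0] by (auto simp: P_def)
  ultimately obtain x where x: "x \<in> M" "norm x = 1" "norm (T x) = min_modulus_on T M"
    using am unfolding abs_min_attaining_def min_attaining_on_def by blast
  \<comment> \<open>The minimum is at most every \<open>norm (T (g n))\<close>, hence at most
    \<open>\<beta>\<close>; then \<open>keyM\<close> forces all inner products with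
    \<open>g n\<close> to vanish.\<close>
  have "norm (T x) \<le> \<beta> + inverse (real (Suc n))" for n
    using min_modulus_on_le[OF gM, of n T] g[of n] x(3) by (auto simp: P_def)
  then have "norm (T x) \<le> \<beta>"
    using LIMSEQ_le_const[OF LIMSEQ_inverse_real_of_nat_add] by blast
  then have Tx: "(norm (T x))\<^sup>2 \<le> \<beta>\<^sup>2" by (simp add: power_mono)
  have "cinner (g n) x = 0" for n
  proof -
    have "(cmod (cinner (g n) x))\<^sup>2 * ((norm (T (g n)))\<^sup>2 - \<beta>\<^sup>2) \<le> 0"
      using keyM[OF x(1), of n] Tx x(2) by simp
    moreover have "0 < (norm (T (g n)))\<^sup>2 - \<beta>\<^sup>2"
      using g[of n] \<beta>0 by (simp add: P_def power_strict_mono)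
    ultimately show ?thesis by (simp add: mult_le_0_iff)
  qed
  then have "range g \<subseteq> orth {x}" by (auto simp: orth_def cinner_eq_0_commute)
  then have "M \<subseteq> orth {x}"
    unfolding M_def by (intro closure_minimal closed_orth cspan_minimal csubspace_orth)
  then have "cinner x x = 0" using x(1) by (auto simp: orth_def)
  then show False using x(2) by (simp add: cinner_eq_zero_iff)
qed

section \<open>From bounds on quadratic forms to essential nullity\<close>

text \<open>Polarization with a multiple of \<open>S y\<close> recovers the norm of a symmetric
  operator from its quadratic form. Since \<open>N\<close> may fail to be invariant,
  \<open>S y\<close> is required to lie in \<open>N\<close> too.\<close>

lemma symmetric_norm_le_form:
  assumes "bounded_clinear S" "\<And>x y. cinner (S x) y = cinner x (S y)"
    and N: "csubspace N" and form: "\<And>y. y \<in> N \<Longrightarrow> \<bar>Re (cinner y (S y))\<bar> \<le> \<epsilon> * (norm y)\<^sup>2"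
    and y: "y \<in> N" "S y \<in> N"
  shows "norm (S y) \<le> \<epsilon> * norm y"
proof (cases "S y = 0 \<or> y = 0")
  case False
  interpret bounded_linear S by (rule bounded_clinear_imp_bounded_linear[OF assms(1)])
  \<comment> \<open>Scaling \<open>S y\<close> to the norm of \<open>y\<close> makes the
    parallelogram law give exactly \<open>4 * (norm y)\<^sup>2\<close>.\<close>
  define z where "z = scaleR (norm y / norm (S y)) (S y)"
  have z: "z \<in> N" "norm z = norm y"
    using False y N by (auto simp: z_def intro: csubspace_scaleR)
  have "Re (cinner z (S y)) = norm y / norm (S y) * (norm (S y))\<^sup>2"
    by (simp add: z_def cinner_scaleR_left cinner_self del: of_real_power)
  also have "\<dots> = norm y * norm (S y)" using False by (simp add: power2_eq_square)
  finally have zS: "Re (cinner z (S y)) = norm y * norm (S y)" .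
  have "Re (cinner y (S z)) = Re (cinner z (S y))"
    by (subst Re_cinner_commute) (simp add: assms(2))
  then have "4 * (norm y * norm (S y)) = Re (cinner (y + z) (S (y + z))) - Re (cinner (y - z) (S (y - z)))"
    by (simp add: add diff cinner_add_left cinner_add_right cinner.diff_left cinner.diff_right zS)
  also have "\<dots> \<le> \<epsilon> * (norm (y + z))\<^sup>2 + \<epsilon> * (norm (y - z))\<^sup>2"
  proof -
    have "y + z \<in> N" "y - z \<in> N" using N y z by (auto simp: csubspace_def intro: csubspace_diff)
    from form[OF this(1)] form[OF this(2)] show ?thesis by linarith
  qed
  also have "\<dots> = \<epsilon> * (4 * (norm y)\<^sup>2)"
    unfolding distrib_left[symmetric] using parallelogram[of y z] z by simp
  finally have "norm (S y) * norm y \<le> (\<epsilon> * norm y) * norm y" by (simp add: power2_eq_square algebra_simps)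
  then show ?thesis using False by (simp add: mult_le_cancel_right)
qed (use form[OF y(1)] assms(1) bounded_linear.linear[OF bounded_clinear_imp_bounded_linear[OF assms(1)]] in
  \<open>auto simp: linear_0 zero_le_mult_iff cinner.zero_right\<close>)

text \<open>On finite codimension the form of \<open>S = T\<^sup>2 - \<beta>\<^sup>2\<close> lies
  between a small negative multiple of the squared norm and 0, so \<open>S\<close> is small there.
  Positivity of \<open>T\<close> bounds the factor \<open>T + \<beta>\<close> below by
  \<open>\<beta>\<close>, which transfers smallness to \<open>T - \<beta>\<close>.\<close>

lemma positive_ess_null:
  fixes T :: "'a::complex_inner \<Rightarrow> 'a"
  assumes pos: "positive_op T"
    and inf: "\<And>G::'a set. finite G \<Longrightarrow> \<exists>x\<in>orth G. norm x = 1"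
    and G0: "finite G0" "\<And>y. y \<in> orth G0 \<Longrightarrow> norm (T y) \<le> ess_min_modulus T * norm y"
  shows "ess_null (\<lambda>x. T x - scaleR (ess_min_modulus T) x)"
  unfolding ess_null_def
proof (intro allI impI)
  fix e :: real assume e: "0 < e"
  define \<beta> where "\<beta> = ess_min_modulus T"
  have bc: "bounded_clinear T" using pos by (simp add: positive_op_def)
  interpret T: bounded_linear T by (rule bounded_clinear_imp_bounded_linear[OF bc])
  note sym = positive_op_symmetric[OF pos]
  have \<beta>0: "0 \<le> \<beta>" unfolding \<beta>_def by (rule ess_min_modulus_nonneg[OF bc inf])
  have G0': "norm (T y) \<le> \<beta> * norm y" if "y \<in> orth G0" for y using G0(2)[OF that] by (simp add: \<beta>_def)
  show "\<exists>G. finite G \<and> (\<forall>x\<in>orth G. norm (T x - scaleR (ess_min_modulus T) x) \<le> e * norm x)"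
    unfolding \<beta>_def[symmetric]
  proof (cases "\<beta> = 0")
    \<comment> \<open>Here the factor \<open>T + \<beta>\<close> has no positive lower bound to use,
      but \<open>T\<close> itself vanishes on \<open>orth G0\<close>.\<close>
    case True
    then show "\<exists>G. finite G \<and> (\<forall>x\<in>orth G. norm (T x - scaleR \<beta> x) \<le> e * norm x)"
      using G0' G0(1) e by (intro exI[of _ G0]) auto
  next
    case False
    then have \<beta>: "0 < \<beta>" using \<beta>0 by simp
    \<comment> \<open>A distance of at most \<open>e / 2\<close> below \<open>\<beta>\<close> yields
      \<open>\<beta>\<^sup>2 - b\<^sup>2 \<le> e * \<beta>\<close>; truncation at 0 allows the lower
      bound to be squared.\<close>
    define b where "b = max 0 (\<beta> - e / 2)"
    have b: "0 \<le> b" "b < \<beta>" using \<beta> e by (auto simp: b_def)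
    have "\<beta> - e / 2 \<le> b" by (simp add: b_def)
    then have "(\<beta> - b) * (\<beta> + b) \<le> e / 2 * (2 * \<beta>)"
      using b e by (intro mult_mono) auto
    then have b2: "\<beta>\<^sup>2 - b\<^sup>2 \<le> e * \<beta>" by (simp add: power2_eq_square algebra_simps)
    obtain G1 where G1: "finite G1" "\<And>y. y \<in> orth G1 \<Longrightarrow> b * norm y \<le> norm (T y)"
      using ess_min_modulus_lower[OF bc inf, of b] b by (auto simp: \<beta>_def)
    define N where "N = orth (G0 \<union> G1)"
    define S where "S x = T (T x) + scaleC (complex_of_real (- (\<beta>\<^sup>2))) x" for x
    have bcS: "bounded_clinear S"
      unfolding S_def by (rule bounded_clinear_add_scaleC[OF bounded_clinear_compose[OF bc bc]])
    have S_eq: "S x = T (T x) - scaleR (\<beta>\<^sup>2) x" for x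
      unfolding S_def scaleR_scaleC[symmetric] by simp
    have symS: "cinner (S x) y = cinner x (S y)" for x y
      by (simp add: S_eq sym cinner.diff_left cinner.diff_right cinner_scaleR_left cinner_scaleR_right)
    have form: "\<bar>Re (cinner y (S y))\<bar> \<le> (e * \<beta>) * (norm y)\<^sup>2" if y: "y \<in> N" for y
    proof -
      have eq: "Re (cinner y (S y)) = (norm (T y))\<^sup>2 - \<beta>\<^sup>2 * (norm y)\<^sup>2"
        by (simp add: S_eq cinner.diff_right cinner_scaleR_right norm_sq_cinner sym)
      have "norm (T y) \<le> \<beta> * norm y" "b * norm y \<le> norm (T y)"
        using y G0' G1(2) by (auto simp: N_def orth_Un)
      then have "(norm (T y))\<^sup>2 \<le> (\<beta> * norm y)\<^sup>2" "(b * norm y)\<^sup>2 \<le> (norm (T y))\<^sup>2"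
        using b by (auto intro!: power_mono)
      moreover have "(\<beta>\<^sup>2 - b\<^sup>2) * (norm y)\<^sup>2 \<le> (e * \<beta>) * (norm y)\<^sup>2"
        using b2 by (intro mult_right_mono) auto
      ultimately show ?thesis
        unfolding eq by (simp add: power_mult_distrib algebra_simps)
    qed
    \<comment> \<open>Adding the images under \<open>S\<close> ensures, by symmetry, that
      \<open>S y\<close> stays in \<open>N\<close>.\<close>
    define G where "G = (G0 \<union> G1) \<union> S ` (G0 \<union> G1)"
    have "norm (T y - scaleR \<beta> y) \<le> e * norm y" if y: "y \<in> orth G" for y
    proof -
      have yN: "y \<in> N" "S y \<in> N"
        using y by (auto simp: G_def N_def orth_def symS[symmetric])
      have "csubspace N" by (simp add: N_def csubspace_orth)
      from symmetric_norm_le_form[OF bcS symS this form yN]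
      have Sy: "norm (S y) \<le> (e * \<beta>) * norm y" .
      define w where "w = T y - scaleR \<beta> y"
      \<comment> \<open>The factorization of \<open>S\<close>; pairing with \<open>w\<close> and
        dropping the nonnegative term of \<open>T\<close> leaves
        \<open>\<beta> * (norm w)\<^sup>2\<close> as a lower bound.\<close>
      have "S y = T w + scaleR \<beta> w"
        by (simp add: w_def S_eq T.diff T.scaleR algebra_simps power2_eq_square)
      then have "Re (cinner w (S y)) = Re (cinner w (T w)) + \<beta> * (norm w)\<^sup>2"
        by (simp add: cinner_add_right cinner_scaleR_right cinner_self del: of_real_power)
      moreover have "0 \<le> Re (cinner w (T w))" using pos by (simp add: positive_op_def)
      moreover have "Re (cinner w (S y)) \<le> norm w * norm (S y)"
        using complex_Re_le_cmod Cauchy_Schwarz order_trans by blast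
      ultimately have "\<beta> * (norm w)\<^sup>2 \<le> norm w * norm (S y)" by linarith
      also have "\<dots> \<le> norm w * ((e * \<beta>) * norm y)" using Sy by (intro mult_left_mono) auto
      finally have "(\<beta> * norm w) * norm w \<le> (\<beta> * norm w) * (e * norm y)"
        by (simp add: power2_eq_square algebra_simps)
      then have "norm w \<le> e * norm y"
        using \<beta> e by (cases "w = 0") (auto simp: mult_le_cancel_left)
      then show ?thesis by (simp add: w_def)
    qed
    moreover have "finite G" using G0(1) G1(1) by (simp add: G_def)
    ultimately show "\<exists>G. finite G \<and> (\<forall>x\<in>orth G. norm (T x - scaleR \<beta> x) \<le> e * norm x)" by blast
  qed
qed

section \<open>The corners of the block operator\<close>

lemma orth_Pair_0: "x \<in> orth (fst ` G) \<Longrightarrow> (x, 0) \<in> orth G"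
  by (auto simp: orth_def cinner_prod_def cinner.zero_right)

lemma orth_0_Pair: "x \<in> orth (snd ` G) \<Longrightarrow> (0, x) \<in> orth G"
  by (auto simp: orth_def cinner_prod_def cinner.zero_right)

theorem theorem4p6:
  fixes A1 :: "'a::{complex_inner,complete_space} \<Rightarrow> 'a"
    and A2 :: "'b::{complex_inner,complete_space} \<Rightarrow> 'b"
    and X :: "'b \<Rightarrow> 'a"
    and T :: "'a \<times> 'b \<Rightarrow> 'a \<times> 'b"
  assumes "separable_inf_dim TYPE('a)" and "separable_inf_dim TYPE('b)"
    and "positive_op A1" and "positive_op A2"
    and "bounded_clinear X"
    and "T = (\<lambda>(x1, x2). (A1 x1 + X x2, cadjoint X x1 + A2 x2))"
    and "positive_op T"
    and "abs_min_attaining T"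
  shows "abs_min_attaining A1 \<and> abs_min_attaining A2 \<and>
         ess_spectrum A1 = ess_spectrum A2 \<and> compact_op X"
proof -
  have inf1: "\<exists>x\<in>orth G. norm x = 1" if "finite G" for G :: "'a set"
    using unit_vector_in_orth[OF _ that] assms(1) by (auto simp: separable_inf_dim_def)
  have inf2: "\<exists>x\<in>orth G. norm x = 1" if "finite G" for G :: "'b set"
    using unit_vector_in_orth[OF _ that] assms(2) by (auto simp: separable_inf_dim_def)
  have inf: "\<exists>x\<in>orth G. norm x = 1" if G: "finite G" for G :: "('a \<times> 'b) set"
  proof -
    obtain x where "x \<in> orth (fst ` G)" "norm x = 1"
      using inf1[OF finite_imageI[OF G, of fst]] by (elim bexE)
    then show ?thesis using orth_Pair_0 by (intro bexI[of _ "(x, 0)"]) auto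
  qed
  have bc: "bounded_clinear T" "bounded_clinear A1" "bounded_clinear A2"
    using assms(3,4,7) by (simp_all add: positive_op_def)
  interpret A1: bounded_linear A1 by (rule bounded_clinear_imp_bounded_linear[OF bc(2)])
  interpret A2: bounded_linear A2 by (rule bounded_clinear_imp_bounded_linear[OF bc(3)])
  interpret X: bounded_linear X by (rule bounded_clinear_imp_bounded_linear[OF assms(5)])
  \<comment> \<open>Linearity of \<open>T\<close> supplies the value of \<open>cadjoint X\<close> at
    0, which identifies the second column of the block matrix.\<close>
  have "T (0, 0) = (0, 0)"
    using linear_0[OF bounded_linear.linear[OF bounded_clinear_imp_bounded_linear[OF bc(1)]]]
    by (simp add: zero_prod_def)
  then have X0: "cadjoint X 0 = 0" by (simp add: assms(6) A2.zero)
  have T1: "T (x, 0) = (A1 x, cadjoint X x)" for x by (simp add: assms(6) X.zero A2.zero)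
  have T2: "T (0, y) = (X y, A2 y)" for y by (simp add: assms(6) X0 A1.zero)
  define \<beta> where "\<beta> = ess_min_modulus T"
  have \<beta>0: "0 \<le> \<beta>" unfolding \<beta>_def by (rule ess_min_modulus_nonneg[OF bc(1) inf])
  obtain G0 where G0: "finite G0" "\<And>y. y \<in> orth G0 \<Longrightarrow> norm (T y) \<le> \<beta> * norm y"
    using abs_min_attaining_ess_bound[OF bc(1) positive_op_symmetric[OF assms(7)] assms(8) inf]
    by (auto simp: \<beta>_def)
  have null: "ess_null (\<lambda>x. T x - scaleR \<beta> x)"
    using positive_ess_null[OF assms(7) inf G0(1)] G0(2) by (simp add: \<beta>_def)
  \<comment> \<open>\<open>A1 x - scaleR \<beta> x\<close> is the first component of
    \<open>T - \<beta>\<close> at \<open>(x, 0)\<close>, so its norm is no larger.\<close>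
  have null1: "ess_null (\<lambda>x. A1 x - scaleR \<beta> x)"
    unfolding ess_null_def
  proof (intro allI impI)
    fix e :: real assume e: "0 < e"
    obtain G where G: "finite G" "\<And>z. z \<in> orth G \<Longrightarrow> norm (T z - scaleR \<beta> z) \<le> e * norm z"
      using null[unfolded ess_null_def, rule_format, OF e] by blast
    have "norm (A1 x - scaleR \<beta> x) \<le> e * norm x" if "x \<in> orth (fst ` G)" for x
      using G(2)[OF orth_Pair_0[OF that]] norm_fst_le[of "A1 x - scaleR \<beta> x" "cadjoint X x"]
      by (simp add: T1)
    then show "\<exists>G. finite G \<and> (\<forall>x\<in>orth G. norm (A1 x - scaleR \<beta> x) \<le> e * norm x)"
      using G(1) by blast
  qed
  \<comment> \<open>The second column gives both facts at once: at \<open>(0, x)\<close> the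
    components of \<open>T - \<beta>\<close> are \<open>X x\<close> and
    \<open>A2 x - scaleR \<beta> x\<close>.\<close>
  have null2: "ess_null (\<lambda>x. A2 x - scaleR \<beta> x)" and nullX: "ess_null X"
  proof -
    have *: "\<exists>G. finite G \<and> (\<forall>x\<in>orth G. norm (A2 x - scaleR \<beta> x) \<le> e * norm x \<and> norm (X x) \<le> e * norm x)"
      if e: "0 < e" for e
    proof -
      obtain G where G: "finite G" "\<And>z. z \<in> orth G \<Longrightarrow> norm (T z - scaleR \<beta> z) \<le> e * norm z"
        using null[unfolded ess_null_def, rule_format, OF e] by blast
      have "norm (A2 x - scaleR \<beta> x) \<le> e * norm x \<and> norm (X x) \<le> e * norm x" if "x \<in> orth (snd ` G)" for x
        using G(2)[OF orth_0_Pair[OF that]] norm_snd_le[of "A2 x - scaleR \<beta> x" "X x"]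
          norm_fst_le[of "X x" "A2 x - scaleR \<beta> x"]
        by (simp add: T2)
      then show ?thesis using G(1) by blast
    qed
    show "ess_null (\<lambda>x. A2 x - scaleR \<beta> x)" "ess_null X"
      unfolding ess_null_def using * by meson+
  qed
  have "norm (A1 y) \<le> \<beta> * norm y" if "y \<in> orth (fst ` G0)" for y
    using G0(2)[OF orth_Pair_0[OF that]] norm_fst_le[of "A1 y" "cadjoint X y"] by (simp add: T1)
  then have "abs_min_attaining A1"
    using abs_min_attaining_of_ess_null[OF bc(2) \<beta>0 null1, of "fst ` G0"] G0(1) by simp
  moreover have "norm (A2 y) \<le> \<beta> * norm y" if "y \<in> orth (snd ` G0)" for y
    using G0(2)[OF orth_0_Pair[OF that]] norm_snd_le[of "A2 y" "X y"] by (simp add: T2)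
  then have "abs_min_attaining A2"
    using abs_min_attaining_of_ess_null[OF bc(3) \<beta>0 null2, of "snd ` G0"] G0(1) by simp
  \<comment> \<open>Both essential spectra are the singleton of the same \<open>\<beta>\<close>, the
    one belonging to \<open>T\<close>.\<close>
  moreover have "ess_spectrum A1 = ess_spectrum A2"
    using ess_spectrum_of_ess_null[OF bc(2) positive_op_symmetric[OF assms(3)] null1 inf1]
      ess_spectrum_of_ess_null[OF bc(3) positive_op_symmetric[OF assms(4)] null2 inf2] by simp
  moreover have "compact_op X" using assms(5) nullX by (rule ess_null_imp_compact_op)
  ultimately show ?thesis by blast
qed

end
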